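(* Let $0<\alpha<4$, $p\in\mathbb S^4$, $\Phi\in L^2(\mathbb S^4)$, and assume that $\mathcal L_\alpha\Phi=0$ in $\mathcal D'(\mathbb S^4\setminus\{p\})$. Then, in geodesic coordinates $(z_1,\dots,z_4)$ centered at $p$, $$\mathcal L_\alpha\Phi=c_0\delta_p+\sum_{j=1}^4c_j\,\partial_{z_j}\delta_p\quad\text{in }\mathcal D'(\mathbb S^4)$$ for suitable constants $c_0,\dots,c_4$.
   Context: All functions are real-valued. On the unit round sphere $\mathbb S^4\subset\mathbb R^5$ with surface measure, $$\mathcal L_\alpha=P_4^{\mathbb S^4}-\kappa_\alpha(\mathcal R_\alpha+\mu_0(\alpha)I),$$ where $P_4^{\mathbb S^4}=(-\Delta_{\mathbb S^4})(-\Delta_{\mathbb S^4}+2)$, $\mathcal R_\alpha\Phi(\xi)=\int_{\mathbb S^4}|\xi-\eta|^{-\alpha}\Phi(\eta)d\eta$ (chordal distance), $\mu_0(\alpha)=\int_{\mathbb S^4}|\xi-\eta|^{-\alpha}d\eta=\frac{2^{6-\alpha}\pi^2}{(6-\alpha)(4-\alpha)}$, and $\kappa_\alpha=\frac{12(8-\alpha)(6-\alpha)(4-\alpha)}{\pi^2}2^{-(8-\alpha)}$. For $\Phi\in L^2(\mathbb S^4)$ the distribution $\mathcal L_\alpha\Phi$ is defined by $\langle\mathcal L_\alpha\Phi,\chi\rangle=\int_{\mathbb S^4}\Phi\,\mathcal L_\alpha\chi\,d\xi$ for smooth $\chi$. Here $\langle\delta_p,\chi\rangle=\chi(p)$ and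 $\langle\partial_{z_j}\delta_p,\chi\rangle=-\partial_{z_j}\chi(p)$. *)

theory Defs
  imports "HOL-Analysis.Analysis"
begin

abbreviation S4 :: "(real ^ 5) set" where
  "S4 \<equiv> sphere 0 1"

text \<open>
  Surface measure from polar coordinates: \<open>\<sigma>(A) = 5 \<cdot> vol {r \<xi> | \<xi> \<in> A, 0 < r \<le> 1}\<close>, because
  \<open>vol {r \<xi> | \<xi> \<in> A, 0 < r \<le> 1} = (\<integral>\<^sub>0\<^sup>1 r\<^sup>4 dr) \<sigma>(A)\<close>.
\<close>

definition surface_measure :: "(real ^ 5) measure" where
  "surface_measure =
     scale_measure 5
       (distr (restrict_space lborel (cball 0 1 - {0})) (restrict_space borel S4)
          (\<lambda>x. x /\<^sub>R norm x))"

definition square_integrable_S4 :: "(real ^ 5 \<Rightarrow> real) \<Rightarrow> bool" where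
  "square_integrable_S4 \<Phi> \<longleftrightarrow>
     \<Phi> \<in> borel_measurable surface_measure \<and> integrable surface_measure (\<lambda>\<xi>. (\<Phi> \<xi>)\<^sup>2)"


subsection \<open>Differential calculus on the sphere\<close>

text \<open>
  A function on the sphere is represented by a function on the ambient space of which only the
  values on the sphere matter. It is differentiated through its extension that is constant along
  rays; since \<open>x \<mapsto> x / |x|\<close> is a smooth retraction of the punctured space onto the sphere, a
  function on the sphere is smooth iff this extension is.
\<close>

definition radial_ext :: "(real ^ 5 \<Rightarrow> 'b) \<Rightarrow> real ^ 5 \<Rightarrow> 'b" where
  "radial_ext f x = f (x /\<^sub>R norm x)"

fun Ck_on :: "nat \<Rightarrow> (real ^ 5) set \<Rightarrow> (real ^ 5 \<Rightarrow> real) \<Rightarrow> bool" where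
  "Ck_on 0 U f \<longleftrightarrow> continuous_on U f"
| "Ck_on (Suc k) U f \<longleftrightarrow>
     (\<forall>x\<in>U. f differentiable (at x)) \<and>
     (\<forall>v. Ck_on k U (\<lambda>x. frechet_derivative f (at x) v))"

definition smooth_S4 :: "(real ^ 5 \<Rightarrow> real) \<Rightarrow> bool" where
  "smooth_S4 f \<longleftrightarrow> (\<forall>k. Ck_on k (- {0}) (radial_ext f))"

text \<open>
  The differential at \<open>\<xi>\<close>: the usual one on the tangent space \<open>\<xi>\<^sup>\<bottom>\<close>, and zero on the normal
  direction \<open>\<xi>\<close>.
\<close>

definition diff_S4 :: "(real ^ 5 \<Rightarrow> 'b::real_normed_vector) \<Rightarrow> real ^ 5 \<Rightarrow> real ^ 5 \<Rightarrow> 'b" where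
  "diff_S4 f \<xi> = frechet_derivative (radial_ext f) (at \<xi>)"

definition grad_S4 :: "(real ^ 5 \<Rightarrow> real) \<Rightarrow> real ^ 5 \<Rightarrow> real ^ 5" where
  "grad_S4 f \<xi> = (\<Sum>b\<in>Basis. diff_S4 f \<xi> b *\<^sub>R b)"

text \<open>
  The covariant derivative of a tangent field \<open>X\<close> in a tangent direction \<open>v\<close> is the tangential
  part of \<open>diff_S4 X \<xi> v\<close>, and the divergence is the trace of \<open>v \<mapsto> \<nabla>\<^sub>v X\<close> over the tangent
  space. As \<open>diff_S4 X \<xi>\<close> vanishes on the normal direction, this is its trace over the whole
  ambient space.
\<close>

definition div_S4 :: "(real ^ 5 \<Rightarrow> real ^ 5) \<Rightarrow> real ^ 5 \<Rightarrow> real" where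
  "div_S4 X \<xi> = (\<Sum>b\<in>Basis. diff_S4 X \<xi> b \<bullet> b)"

definition laplacian_S4 :: "(real ^ 5 \<Rightarrow> real) \<Rightarrow> real ^ 5 \<Rightarrow> real" where
  "laplacian_S4 f = div_S4 (grad_S4 f)"


subsection \<open>The operator\<close>

definition P4_S4 :: "(real ^ 5 \<Rightarrow> real) \<Rightarrow> real ^ 5 \<Rightarrow> real" where
  "P4_S4 f = (\<lambda>\<xi>. - laplacian_S4 (\<lambda>\<eta>. - laplacian_S4 f \<eta> + 2 * f \<eta>) \<xi>)"

definition R_op :: "real \<Rightarrow> (real ^ 5 \<Rightarrow> real) \<Rightarrow> real ^ 5 \<Rightarrow> real" where
  "R_op \<alpha> f \<xi> = (LINT \<eta>|surface_measure. norm (\<xi> - \<eta>) powr (- \<alpha>) * f \<eta>)"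

text \<open>
  By rotation invariance this does not depend on the point \<open>\<xi>\<close> of the sphere; for \<open>\<alpha> < 4\<close> its
  value is \<open>2 powr (6 - \<alpha>) * pi\<^sup>2 / ((6 - \<alpha>) * (4 - \<alpha>))\<close>.
\<close>

definition mu0 :: "real \<Rightarrow> real ^ 5 \<Rightarrow> real" where
  "mu0 \<alpha> \<xi> = (LINT \<eta>|surface_measure. norm (\<xi> - \<eta>) powr (- \<alpha>))"

definition kappa :: "real \<Rightarrow> real" where
  "kappa \<alpha> = 12 * (8 - \<alpha>) * (6 - \<alpha>) * (4 - \<alpha>) / pi\<^sup>2 * 2 powr (- (8 - \<alpha>))"

definition L_op :: "real \<Rightarrow> (real ^ 5 \<Rightarrow> real) \<Rightarrow> real ^ 5 \<Rightarrow> real" where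
  "L_op \<alpha> f \<xi> = P4_S4 f \<xi> - kappa \<alpha> * (R_op \<alpha> f \<xi> + mu0 \<alpha> \<xi> * f \<xi>)"


subsection \<open>Distributions\<close>

text \<open>
  Distributions are represented by their action on test functions. For \<open>U\<close> relatively open in the
  sphere the support of a test function is automatically compact.
\<close>

type_synonym distribution = "(real ^ 5 \<Rightarrow> real) \<Rightarrow> real"

definition test_functions :: "(real ^ 5) set \<Rightarrow> (real ^ 5 \<Rightarrow> real) set" where
  "test_functions U = {\<psi>. smooth_S4 \<psi> \<and> closure {\<xi> \<in> S4. \<psi> \<xi> \<noteq> 0} \<subseteq> U}"

definition distr_eq_on :: "(real ^ 5) set \<Rightarrow> distribution \<Rightarrow> distribution \<Rightarrow> bool" where
  "distr_eq_on U S T \<longleftrightarrow> (\<forall>\<psi>\<in>test_functions U. S \<psi> = T \<psi>)"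

definition L_distr :: "real \<Rightarrow> (real ^ 5 \<Rightarrow> real) \<Rightarrow> distribution" where
  "L_distr \<alpha> \<Phi> \<psi> = (LINT \<xi>|surface_measure. \<Phi> \<xi> * L_op \<alpha> \<psi> \<xi>)"

definition delta :: "real ^ 5 \<Rightarrow> distribution" where
  "delta p \<psi> = \<psi> p"


subsection \<open>Geodesic coordinates\<close>

definition orthonormal_tangent_frame :: "real ^ 5 \<Rightarrow> (4 \<Rightarrow> real ^ 5) \<Rightarrow> bool" where
  "orthonormal_tangent_frame p e \<longleftrightarrow>
     (\<forall>j. e j \<bullet> p = 0) \<and> (\<forall>i j. e i \<bullet> e j = (if i = j then 1 else 0))"

text \<open>
  The exponential map at \<open>p\<close> in the frame \<open>e\<close>, that is, the inverse of the geodesic coordinate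
  chart. At \<open>z = 0\<close> it gives \<open>p\<close>, as division by zero yields zero.
\<close>

definition geodesic_param :: "real ^ 5 \<Rightarrow> (4 \<Rightarrow> real ^ 5) \<Rightarrow> real ^ 4 \<Rightarrow> real ^ 5" where
  "geodesic_param p e z =
     cos (norm z) *\<^sub>R p + (sin (norm z) / norm z) *\<^sub>R (\<Sum>j\<in>UNIV. (z $ j) *\<^sub>R e j)"

definition partial_z :: "real ^ 5 \<Rightarrow> (4 \<Rightarrow> real ^ 5) \<Rightarrow> 4 \<Rightarrow> (real ^ 5 \<Rightarrow> real) \<Rightarrow> real" where
  "partial_z p e j \<psi> = deriv (\<lambda>t. \<psi> (geodesic_param p e (t *\<^sub>R axis j 1))) 0"

definition partial_delta :: "real ^ 5 \<Rightarrow> (4 \<Rightarrow> real ^ 5) \<Rightarrow> 4 \<Rightarrow> distribution" where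
  "partial_delta p e j \<psi> = - partial_z p e j \<psi>"

end

theory Submission
  imports Defs
begin

text \<open>
  The point is that \<open>T = L_distr \<alpha> \<Phi>\<close> annihilates every smooth \<open>\<psi>\<close> that vanishes to second order
  at \<open>p\<close>; subtracting from a general test function its value at \<open>p\<close> and a combination of the linear
  functions \<open>x \<bullet> e j\<close> then gives the claim. With a cutoff \<open>\<eta>\<close> at scale \<open>\<epsilon>\<close> around \<open>p\<close>, the hypothesis gives
  \<open>T \<psi> = T (\<eta> \<psi>)\<close>. By scaling, \<open>P\<^sub>4 (\<eta> \<psi>) = O(\<epsilon>\<^sup>2 / \<epsilon>\<^sup>4)\<close> on a cap of measure \<open>O(\<epsilon>\<^sup>4)\<close>, so \<open>P\<^sub>4 (\<eta> \<psi>)\<close> is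
  bounded in \<open>L\<^sup>2\<close> while the mass of \<open>\<Phi>\<^sup>2\<close> on the cap tends to zero; the nonlocal part is
  \<open>O(sup \<bar>\<eta> \<psi>\<bar>) = O(\<epsilon>\<^sup>2)\<close>. Hence \<open>T \<psi> = 0\<close>.
\<close>

subsection \<open>Smooth functions on the punctured space\<close>

text \<open>The exponents are critical. A function of size \<epsilon>^(-2) on a set of measure
  \<epsilon>^4 has \<open>L\<^sup>2\<close> norm of order one, with no decay to spare, so all
  smallness must come from the mass of \<Phi>^2 near p; vanishing to second order is what makes this
  balance work. The first-order jets at p that remain are spanned by the five functions 1 and
  \<open>x \<bullet> e j\<close>, and the values of T on these give the coefficients, up to the sign
  in \<open>partial_delta\<close>.

  The main burden is a bound, uniform in \<epsilon>, on four derivatives of the truncated function.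
  To avoid charts, all calculus takes place in the punctured ambient space: functions on the sphere
  become functions constant along rays, derivatives are taken in fixed Cartesian directions, and the
  estimates reduce to bookkeeping of exponents under product and chain rules. Smoothness is stated
  for arbitrary functions off the origin because factors such as the norm and linear functions are
  not constant along rays.\<close>

definition smooth_punctured :: "(real ^ 5 \<Rightarrow> real) \<Rightarrow> bool" where
  "smooth_punctured F \<longleftrightarrow> (\<forall>k. Ck_on k (- {0}) F)"

lemma Ck_on_cong_open:
  assumes "open U" "\<And>x. x \<in> U \<Longrightarrow> f x = g x" "Ck_on k U f"
  shows "Ck_on k U g"
  using assms(2,3)
proof (induction k arbitrary: f g)
  case 0
  then show ?case by (simp cong: continuous_on_cong)
next
  case (Suc k)
  have der: "(g has_derivative frechet_derivative f (at x)) (at x)" if "x \<in> U" for x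
  proof (rule has_derivative_transform_within_open)
    show "(f has_derivative frechet_derivative f (at x)) (at x)"
      using Suc.prems that by (simp flip: frechet_derivative_works)
  qed (use that assms(1) Suc.prems in auto)
  have "Ck_on k U (\<lambda>x. frechet_derivative g (at x) v)" for v
  proof (rule Suc.IH)
    show "frechet_derivative f (at x) v = frechet_derivative g (at x) v" if "x \<in> U" for x
      using frechet_derivative_at[OF der[OF that]] by simp
    show "Ck_on k U (\<lambda>x. frechet_derivative f (at x) v)"
      using Suc.prems by simp
  qed
  then show ?case
    using der by (auto simp: differentiable_def)
qed

lemma Ck_on_Suc_imp: "Ck_on (Suc k) U f \<Longrightarrow> Ck_on k U f"
proof (induction k arbitrary: f)
  case 0
  then show ?case
    by (auto intro!: differentiable_imp_continuous_on
        simp: differentiable_on_def differentiable_at_withinI)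
next
  case (Suc k)
  then show ?case by (subst Ck_on.simps) auto
qed

text \<open>\<open>Ck_on\<close> refers to the derivative selected by
  \<open>frechet_derivative\<close>. By uniqueness any exhibited derivative agrees with it on U, and
  openness of U carries this agreement through all further orders.\<close>

lemma Ck_on_SucI:
  assumes "open U" "\<And>x. x \<in> U \<Longrightarrow> (f has_derivative f' x) (at x)"
    and "\<And>v. Ck_on k U (\<lambda>x. f' x v)"
  shows "Ck_on (Suc k) U f"
proof -
  have "Ck_on k U (\<lambda>x. frechet_derivative f (at x) v)" for v
    by (rule Ck_on_cong_open[OF assms(1) _ assms(3)[of v]])
      (use frechet_derivative_at[OF assms(2)] in simp)
  then show ?thesis
    using assms(2) by (auto simp: differentiable_def)
qed

lemma Ck_on_Suc_has_derivative:
  "Ck_on (Suc k) U f \<Longrightarrow> x \<in> U \<Longrightarrow> (f has_derivative frechet_derivative f (at x)) (at x)"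
  by (simp flip: frechet_derivative_works)

lemma Ck_on_const: "Ck_on k U (\<lambda>x. c)"
proof (induction k arbitrary: c)
  case (Suc k)
  then show ?case by (auto simp: frechet_derivative_const)
qed auto

lemma Ck_on_inner: "Ck_on k U (\<lambda>x. x \<bullet> a)"
proof (cases k)
  case (Suc n)
  have "((\<lambda>x. x \<bullet> a) has_derivative (\<lambda>v. v \<bullet> a)) (at x)" for x
    by (auto intro!: derivative_eq_intros)
  from frechet_derivative_at[OF this] have "frechet_derivative (\<lambda>x. x \<bullet> a) (at x) = (\<lambda>v. v \<bullet> a)" for x
    by simp
  then show ?thesis
    unfolding Suc by (auto simp: Ck_on_const intro!: derivative_intros differentiable_inner)
qed (auto intro!: continuous_intros)

lemma Ck_on_add:
  assumes "open U"
  shows "Ck_on k U f \<Longrightarrow> Ck_on k U g \<Longrightarrow> Ck_on k U (\<lambda>x. f x + g x)"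
proof (induction k arbitrary: f g)
  case (Suc k)
  show ?case
    by (rule Ck_on_SucI[OF assms has_derivative_add[OF
            Ck_on_Suc_has_derivative[OF Suc.prems(1)] Ck_on_Suc_has_derivative[OF Suc.prems(2)]]])
      (use Suc in auto)
qed (auto intro: continuous_on_add)

lemma Ck_on_mult:
  assumes "open U"
  shows "Ck_on k U f \<Longrightarrow> Ck_on k U g \<Longrightarrow> Ck_on k U (\<lambda>x. f x * g x)"
proof (induction k arbitrary: f g)
  case (Suc k)
  \<comment> \<open>Keeps the premises in the form \<open>Ck_on (Suc k)\<close>, to which
    \<open>Ck_on_Suc_imp\<close> applies at the end: in the product rule each factor also occurs
    undifferentiated.\<close>
  note [simp del] = Ck_on.simps
  have "Ck_on k U (\<lambda>x. frechet_derivative f (at x) v)" "Ck_on k U (\<lambda>x. frechet_derivative g (at x) v)" for v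
    using Suc.prems by (auto simp: Ck_on.simps)
  then show ?case
    by (intro Ck_on_SucI[OF assms has_derivative_mult[OF
            Ck_on_Suc_has_derivative[OF Suc.prems(1)] Ck_on_Suc_has_derivative[OF Suc.prems(2)]]]
         Ck_on_add[OF assms] Suc.IH)
      (use Suc.prems in \<open>auto intro: Ck_on_Suc_imp\<close>)
qed (auto intro: continuous_on_mult)

lemma smooth_punctured_cong:
  "(\<And>x. x \<noteq> 0 \<Longrightarrow> f x = g x) \<Longrightarrow> smooth_punctured f \<Longrightarrow> smooth_punctured g"
  unfolding smooth_punctured_def by (intro allI Ck_on_cong_open[of "- {0}" f g]) auto

lemma smooth_punctured_const: "smooth_punctured (\<lambda>x. c)"
  and smooth_punctured_inner: "smooth_punctured (\<lambda>x. x \<bullet> a)"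
  and smooth_punctured_add: "smooth_punctured f \<Longrightarrow> smooth_punctured g \<Longrightarrow> smooth_punctured (\<lambda>x. f x + g x)"
  and smooth_punctured_mult: "smooth_punctured f \<Longrightarrow> smooth_punctured g \<Longrightarrow> smooth_punctured (\<lambda>x. f x * g x)"
  by (simp_all add: smooth_punctured_def Ck_on_const Ck_on_inner Ck_on_add Ck_on_mult open_Compl)

lemma smooth_punctured_minus: "smooth_punctured f \<Longrightarrow> smooth_punctured (\<lambda>x. - f x)"
  using smooth_punctured_mult[OF smooth_punctured_const[of "-1"]] by simp

lemma smooth_punctured_diff:
  "smooth_punctured f \<Longrightarrow> smooth_punctured g \<Longrightarrow> smooth_punctured (\<lambda>x. f x - g x)"
  using smooth_punctured_add[OF _ smooth_punctured_minus] by simp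

lemma smooth_punctured_sum:
  "(\<And>i. i \<in> I \<Longrightarrow> smooth_punctured (f i)) \<Longrightarrow> smooth_punctured (\<lambda>x. \<Sum>i\<in>I. f i x)"
  by (induction I rule: infinite_finite_induct)
    (auto intro: smooth_punctured_const smooth_punctured_add)

lemma smooth_punctured_frechet:
  assumes "smooth_punctured f"
  shows "smooth_punctured (\<lambda>x. frechet_derivative f (at x) v)"
  unfolding smooth_punctured_def
proof
  fix k
  from assms have "Ck_on (Suc k) (- {0}) f" unfolding smooth_punctured_def by blast
  then show "Ck_on k (- {0}) (\<lambda>x. frechet_derivative f (at x) v)" by simp
qed

lemma smooth_punctured_has_derivative:
  assumes "smooth_punctured f" "x \<noteq> 0"
  shows "(f has_derivative frechet_derivative f (at x)) (at x)"
  using assms Ck_on_Suc_has_derivative[of 0 "- {0}" f x] unfolding smooth_punctured_def by blast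

lemma smooth_punctured_continuous:
  assumes "smooth_punctured f"
  shows "continuous_on (- {0}) f"
proof -
  have "Ck_on 0 (- {0}) f" using assms unfolding smooth_punctured_def by blast
  then show ?thesis by simp
qed

text \<open>The derivative -(x . v) |x|^(-3) is again a product of a linear function and inverse
  norms, so the induction closes on this function. It would not close on the norm, whose derivative
  already contains the inverse norm; the norm is recovered afterwards as |x|^2 times the inverse
  norm.\<close>

lemma smooth_punctured_inverse_norm: "smooth_punctured (\<lambda>x. inverse (norm x))"
  unfolding smooth_punctured_def
proof
  fix k
  have op: "open (- {0::real ^ 5})" by (simp add: open_Compl)
  show "Ck_on k (- {0::real ^ 5}) (\<lambda>x. inverse (norm x))"
  proof (induction k)
    case 0
    then show ?case by (auto intro!: continuous_intros)
  next
    case (Suc k)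
    show ?case
    proof (rule Ck_on_SucI[OF op])
      fix x :: "real ^ 5" assume "x \<in> - {0}"
      then show "((\<lambda>x. inverse (norm x)) has_derivative
          (\<lambda>v. (- 1) * ((x \<bullet> v) * (inverse (norm x) * (inverse (norm x) * inverse (norm x)))))) (at x)"
        by (auto intro!: derivative_eq_intros has_derivative_norm simp: sgn_div_norm inner_commute field_simps)
    next
      fix v :: "real ^ 5"
      show "Ck_on k (- {0}) (\<lambda>x. (- 1) * ((x \<bullet> v) * (inverse (norm x) * (inverse (norm x) * inverse (norm x)))))"
        by (intro Ck_on_mult[OF op] Ck_on_const Ck_on_inner Suc.IH)
    qed
  qed
qed

lemma smooth_punctured_norm: "smooth_punctured norm"
proof (rule smooth_punctured_cong)
  show "smooth_punctured (\<lambda>x. (\<Sum>b\<in>Basis. (x \<bullet> b) * (x \<bullet> b)) * inverse (norm x))"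
    by (intro smooth_punctured_mult smooth_punctured_sum smooth_punctured_inner
        smooth_punctured_inverse_norm)
  show "(\<Sum>b\<in>Basis. (x \<bullet> b) * (x \<bullet> b)) * inverse (norm x) = norm x" if "x \<noteq> 0" for x :: "real ^ 5"
    using that unfolding euclidean_inner[symmetric] dot_square_norm by (simp add: power2_eq_square)
qed

subsection \<open>Flat functions and the spherical operators\<close>

text \<open>\<open>exp_flat 1\<close> is the flat function \<open>t \<mapsto> exp (- 1 / t)\<close>; the polynomial parameter makes the
  family closed under differentiation.\<close>

definition exp_flat :: "real poly \<Rightarrow> real \<Rightarrow> real" where
  "exp_flat P t = (if t > 0 then poly P (1 / t) * exp (- 1 / t) else 0)"

lemma tendsto_poly_div_exp_0: "((\<lambda>x. poly P x / exp x) \<longlongrightarrow> (0::real)) at_top"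
proof -
  have "((\<lambda>x. \<Sum>i\<le>degree P. coeff P i * (x ^ i / exp x)) \<longlongrightarrow> (\<Sum>i\<le>degree P. coeff P i * 0)) at_top"
    by (intro tendsto_sum tendsto_mult tendsto_const tendsto_power_div_exp_0)
  then show ?thesis
    by (simp add: poly_altdef sum_divide_distrib)
qed

text \<open>With s = 1 / t, the t-derivative of P(s) exp(-s) is s^2 (P(s) - P'(s)) exp(-s), and
  \<open>[:0, 0, 1:]\<close> is the polynomial s^2. At zero only the right-hand difference quotient
  is nontrivial: it equals s P(s) exp(-s), whose polynomial factor is \<open>pCons 0 P\<close>, and
  s tends to infinity.\<close>

lemma exp_flat_has_derivative:
  "(exp_flat P has_real_derivative exp_flat ([:0, 0, 1:] * (P - pderiv P)) t) (at t)"
proof -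
  consider "t > 0" | "t < 0" | "t = 0" by linarith
  then show ?thesis
  proof cases
    case 1
    have "((\<lambda>t. poly P (1 / t) * exp (- 1 / t)) has_real_derivative
        exp_flat ([:0, 0, 1:] * (P - pderiv P)) t) (at t)"
      using 1 by (auto intro!: derivative_eq_intros DERIV_chain'[where g = "poly P"] poly_DERIV
          simp: exp_flat_def power2_eq_square field_simps)
    then show ?thesis
      by (rule has_field_derivative_transform_within_open[of _ _ _ "{0<..}"])
        (use 1 in \<open>auto simp: exp_flat_def\<close>)
  next
    case 2
    have "((\<lambda>t. 0) has_real_derivative exp_flat ([:0, 0, 1:] * (P - pderiv P)) t) (at t)"
      using 2 by (simp add: exp_flat_def)
    then show ?thesis
      by (rule has_field_derivative_transform_within_open[of _ _ _ "{..<0}"])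
        (use 2 in \<open>auto simp: exp_flat_def\<close>)
  next
    case 3
    have "((\<lambda>h. exp_flat P h / h) \<longlongrightarrow> 0) (at_left 0)"
      by (rule tendsto_eventually) (auto simp: eventually_at_left_field exp_flat_def intro: exI[of _ "-1"])
    moreover have "((\<lambda>h. exp_flat P h / h) \<longlongrightarrow> 0) (at_right 0)"
    proof (rule Lim_transform_eventually)
      show "((\<lambda>h. poly (pCons 0 P) (inverse h) / exp (inverse h)) \<longlongrightarrow> 0) (at_right (0::real))"
        by (rule filterlim_compose[OF tendsto_poly_div_exp_0 filterlim_inverse_at_top_right])
      show "\<forall>\<^sub>F h in at_right 0. poly (pCons 0 P) (inverse h) / exp (inverse h) = exp_flat P h / h"
        by (rule eventually_mono[OF eventually_at_right_less])
          (auto simp: exp_flat_def exp_minus field_simps)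
    qed
    ultimately have "((\<lambda>h. exp_flat P h / h) \<longlongrightarrow> 0) (at 0)"
      by (rule filterlim_split_at)
    then show ?thesis
      using 3 by (simp add: DERIV_def exp_flat_def)
  qed
qed

lemma exp_flat_continuous: "continuous_on S (exp_flat P)"
  using exp_flat_has_derivative DERIV_isCont continuous_at_imp_continuous_on by blast

lemma exp_flat_compose_has_derivative:
  assumes "(g has_derivative g') (at x)"
  shows "((\<lambda>x. exp_flat P (g x)) has_derivative
    (\<lambda>v. g' v * exp_flat ([:0, 0, 1:] * (P - pderiv P)) (g x))) (at x)"
  by (rule DERIV_compose_FDERIV[OF exp_flat_has_derivative assms])

lemma Ck_on_exp_flat:
  assumes "open U"
  shows "Ck_on k U g \<Longrightarrow> Ck_on k U (\<lambda>x. exp_flat P (g x))"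
proof (induction k arbitrary: P)
  case 0
  then show ?case
    using continuous_on_compose[OF _ exp_flat_continuous, of U g P] by (simp add: comp_def)
next
  case (Suc k)
  have "Ck_on k U (\<lambda>x. frechet_derivative g (at x) v)" for v
    using Suc.prems by simp
  then show ?case
    by (intro Ck_on_SucI[OF assms exp_flat_compose_has_derivative[OF
            Ck_on_Suc_has_derivative[OF Suc.prems]]] Ck_on_mult[OF assms] Suc.IH)
      (use Ck_on_Suc_imp[OF Suc.prems] in auto)
qed

lemma smooth_punctured_exp_flat:
  "smooth_punctured g \<Longrightarrow> smooth_punctured (\<lambda>x. exp_flat P (g x))"
  by (simp add: smooth_punctured_def Ck_on_exp_flat open_Compl)

section \<open>Functions constant along rays, and the spherical operators in Cartesian form\<close>

definition degree_0 :: "(real ^ 5 \<Rightarrow> real) \<Rightarrow> bool" where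
  "degree_0 F \<longleftrightarrow> (\<forall>t>0. \<forall>x. x \<noteq> 0 \<longrightarrow> F (t *\<^sub>R x) = F x)"

text \<open>The factor \<open>norm x\<close> turns a derivative of a function that is constant along rays into such a
  function again, so the operators below can be iterated without restricting to the sphere.\<close>

definition sph_deriv :: "real ^ 5 \<Rightarrow> (real ^ 5 \<Rightarrow> real) \<Rightarrow> real ^ 5 \<Rightarrow> real" where
  "sph_deriv b F x = norm x * frechet_derivative F (at x) b"

definition sph_lap :: "(real ^ 5 \<Rightarrow> real) \<Rightarrow> real ^ 5 \<Rightarrow> real" where
  "sph_lap F x = (\<Sum>b\<in>Basis. sph_deriv b (sph_deriv b F) x)"

definition sph_paneitz :: "(real ^ 5 \<Rightarrow> real) \<Rightarrow> real ^ 5 \<Rightarrow> real" where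
  "sph_paneitz F x = - sph_lap (\<lambda>y. - sph_lap F y + 2 * F y) x"

lemma degree_0_radial_ext: "degree_0 (radial_ext f)"
  unfolding degree_0_def radial_ext_def
proof (intro allI impI)
  fix t :: real and x :: "real ^ 5"
  assume "t > 0"
  then have "(t *\<^sub>R x) /\<^sub>R norm (t *\<^sub>R x) = x /\<^sub>R norm x"
    by simp
  then show "f ((t *\<^sub>R x) /\<^sub>R norm (t *\<^sub>R x)) = f (x /\<^sub>R norm x)"
    by (simp only:)
qed

text \<open>Differentiating the identity F (t x) = F x shows that the differential is homogeneous of
  degree -1. The choice t = 1 / |x| compares a point with its projection to the sphere.\<close>

lemma frechet_derivative_scale:
  assumes "smooth_punctured F" "degree_0 F" "x \<noteq> 0" "t > 0"
  shows "frechet_derivative F (at x) v = t * frechet_derivative F (at (t *\<^sub>R x)) v"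
proof -
  have F': "(F has_derivative frechet_derivative F (at (t *\<^sub>R x))) (at (t *\<^sub>R x))"
    by (rule smooth_punctured_has_derivative) (use assms in auto)
  have "((\<lambda>x. F (t *\<^sub>R x)) has_derivative (\<lambda>v. frechet_derivative F (at (t *\<^sub>R x)) (t *\<^sub>R v))) (at x)"
    by (rule has_derivative_compose[where f = "\<lambda>x. t *\<^sub>R x", OF _ F'])
      (auto intro!: derivative_eq_intros)
  then have "(F has_derivative (\<lambda>v. frechet_derivative F (at (t *\<^sub>R x)) (t *\<^sub>R v))) (at x)"
    by (rule has_derivative_transform_within_open[of _ _ _ _ "- {0}"])
      (use assms in \<open>auto simp: degree_0_def\<close>)
  then have "frechet_derivative F (at x) v = frechet_derivative F (at (t *\<^sub>R x)) (t *\<^sub>R v)"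
    by (rule fun_cong[OF frechet_derivative_at, symmetric])
  then show ?thesis
    using linear_cmul[OF has_derivative_linear[OF F']] by simp
qed

lemma smooth_punctured_sph_deriv: "smooth_punctured F \<Longrightarrow> smooth_punctured (sph_deriv b F)"
  using smooth_punctured_mult[OF smooth_punctured_norm smooth_punctured_frechet]
  by (auto simp: sph_deriv_def[abs_def])

lemma smooth_punctured_sph_lap: "smooth_punctured F \<Longrightarrow> smooth_punctured (sph_lap F)"
  unfolding sph_lap_def[abs_def]
  by (intro smooth_punctured_sum smooth_punctured_sph_deriv)

lemma smooth_punctured_sph_paneitz_arg:
  "smooth_punctured F \<Longrightarrow> smooth_punctured (\<lambda>y. - sph_lap F y + 2 * F y)"
  by (intro smooth_punctured_minus smooth_punctured_add smooth_punctured_mult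
      smooth_punctured_const smooth_punctured_sph_lap)

lemma smooth_punctured_sph_paneitz: "smooth_punctured F \<Longrightarrow> smooth_punctured (sph_paneitz F)"
  unfolding sph_paneitz_def[abs_def]
  by (intro smooth_punctured_minus smooth_punctured_sph_lap smooth_punctured_sph_paneitz_arg)

lemma degree_0_sph_deriv:
  assumes "smooth_punctured F" "degree_0 F"
  shows "degree_0 (sph_deriv b F)"
  unfolding degree_0_def
proof (intro allI impI)
  fix t :: real and x :: "real ^ 5"
  assume "t > 0" "x \<noteq> 0"
  from frechet_derivative_scale[OF assms this(2,1), of b] \<open>t > 0\<close>
  show "sph_deriv b F (t *\<^sub>R x) = sph_deriv b F x"
    by (simp add: sph_deriv_def)
qed

lemma sph_deriv_cong_open:
  assumes "open W" "\<And>x. x \<in> W \<Longrightarrow> F x = G x" "x \<in> W"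
    and "smooth_punctured F" "0 \<notin> W"
  shows "sph_deriv b F x = sph_deriv b G x"
proof -
  have "F differentiable at x"
    using smooth_punctured_has_derivative[OF assms(4), of x] assms(3,5) by (auto simp: differentiable_def)
  then show ?thesis
    using frechet_derivative_transform_within_open[OF _ assms(1,3,2)] by (simp add: sph_deriv_def)
qed

lemma sph_lap_cong_open:
  assumes "open W" "\<And>x. x \<in> W \<Longrightarrow> F x = G x" "x \<in> W"
    and "smooth_punctured F" "0 \<notin> W"
  shows "sph_lap F x = sph_lap G x"
  unfolding sph_lap_def
proof (rule sum.cong[OF refl])
  fix b
  show "sph_deriv b (sph_deriv b F) x = sph_deriv b (sph_deriv b G) x"
    by (rule sph_deriv_cong_open[OF assms(1) sph_deriv_cong_open[OF assms(1,2) _ assms(4,5)] assms(3)])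
      (use assms in \<open>auto intro: smooth_punctured_sph_deriv\<close>)
qed

text \<open>Locality of the fourth-order operator. It makes the operator vanish on a truncated
  function away from \<open>p\<close>, and it allows formulas that agree only off the origin to be
  exchanged. G inherits its derivatives on W from F.\<close>

lemma sph_paneitz_cong_open:
  assumes "open W" "\<And>x. x \<in> W \<Longrightarrow> F x = G x" "x \<in> W"
    and "smooth_punctured F" "0 \<notin> W"
  shows "sph_paneitz F x = sph_paneitz G x"
proof -
  have "sph_lap (\<lambda>y. - sph_lap F y + 2 * F y) x = sph_lap (\<lambda>y. - sph_lap G y + 2 * G y) x"
    by (rule sph_lap_cong_open[OF assms(1) _ assms(3) smooth_punctured_sph_paneitz_arg[OF assms(4)] assms(5)])
      (use assms(2) sph_lap_cong_open[OF assms(1,2) _ assms(4,5)] in simp)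
  then show ?thesis by (simp add: sph_paneitz_def)
qed

lemma sph_paneitz_0: "sph_paneitz (\<lambda>x. 0) x = 0"
  by (simp add: sph_paneitz_def sph_lap_def sph_deriv_def[abs_def])

lemma sph_deriv_add_cmult:
  assumes "smooth_punctured F" "smooth_punctured G" "x \<noteq> 0"
  shows "sph_deriv b (\<lambda>x. F x + c * G x) x = sph_deriv b F x + c * sph_deriv b G x"
proof -
  have "((\<lambda>x. F x + c * G x) has_derivative
      (\<lambda>v. frechet_derivative F (at x) v + c * frechet_derivative G (at x) v)) (at x)"
    using assms by (auto intro!: derivative_eq_intros smooth_punctured_has_derivative)
  from frechet_derivative_at[OF this, symmetric] show ?thesis
    by (simp add: sph_deriv_def algebra_simps)
qed

lemma sph_lap_add_cmult:
  assumes "smooth_punctured F" "smooth_punctured G" "x \<noteq> 0"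
  shows "sph_lap (\<lambda>x. F x + c * G x) x = sph_lap F x + c * sph_lap G x"
proof -
  have "sph_deriv b (sph_deriv b (\<lambda>x. F x + c * G x)) x
      = sph_deriv b (\<lambda>x. sph_deriv b F x + c * sph_deriv b G x) x" for b
    by (rule sph_deriv_cong_open[of "- {0}"])
      (use assms in \<open>auto intro!: sph_deriv_add_cmult smooth_punctured_sph_deriv smooth_punctured_add
        smooth_punctured_mult smooth_punctured_const\<close>)
  then show ?thesis
    using assms by (simp add: sph_lap_def sph_deriv_add_cmult smooth_punctured_sph_deriv
        sum.distrib sum_distrib_left)
qed

lemma sph_paneitz_add_cmult:
  assumes "smooth_punctured F" "smooth_punctured G" "x \<noteq> 0"
  shows "sph_paneitz (\<lambda>x. F x + c * G x) x = sph_paneitz F x + c * sph_paneitz G x"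
proof -
  note sm = smooth_punctured_sph_paneitz_arg
  have "smooth_punctured (\<lambda>x. F x + c * G x)"
    using assms by (intro smooth_punctured_add smooth_punctured_mult smooth_punctured_const)
  note smFG = sm[OF this]
  have "sph_lap (\<lambda>y. - sph_lap (\<lambda>x. F x + c * G x) y + 2 * (F y + c * G y)) x
      = sph_lap (\<lambda>y. (- sph_lap F y + 2 * F y) + c * (- sph_lap G y + 2 * G y)) x"
    by (rule sph_lap_cong_open[of "- {0}", OF _ _ _ smFG])
      (use assms in \<open>auto simp: sph_lap_add_cmult algebra_simps\<close>)
  also have "\<dots> = sph_lap (\<lambda>y. - sph_lap F y + 2 * F y) x + c * sph_lap (\<lambda>y. - sph_lap G y + 2 * G y) x"
    using assms by (intro sph_lap_add_cmult sm)
  finally show ?thesis by (simp add: sph_paneitz_def)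
qed

lemma radial_ext_grad_S4:
  assumes "smooth_punctured (radial_ext f)" "x \<noteq> 0"
  shows "radial_ext (grad_S4 f) x = (\<Sum>b\<in>Basis. sph_deriv b (radial_ext f) x *\<^sub>R b)"
proof -
  have "frechet_derivative (radial_ext f) (at (x /\<^sub>R norm x)) b = sph_deriv b (radial_ext f) x" for b
    using frechet_derivative_scale[OF assms(1) degree_0_radial_ext assms(2), of "inverse (norm x)" b]
      assms(2) by (simp add: sph_deriv_def field_simps)
  then show ?thesis
    by (simp add: radial_ext_def[of "grad_S4 f"] grad_S4_def diff_S4_def)
qed

text \<open>The components of the gradient extend along rays to \<open>sph_deriv b\<close> of the
  extension, so the divergence differentiates each of them once more in its own direction b. The
  factor \<open>norm x\<close> is 1 on the sphere and, off it, compensates the degree -1 of the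
  second derivative.\<close>

lemma radial_ext_laplacian_S4:
  assumes "smooth_punctured (radial_ext f)" "x \<noteq> 0"
  shows "radial_ext (laplacian_S4 f) x = sph_lap (radial_ext f) x"
proof -
  let ?F = "radial_ext f"
  have "diff_S4 (grad_S4 f) \<xi> v = (\<Sum>b\<in>Basis. frechet_derivative (sph_deriv b ?F) (at \<xi>) v *\<^sub>R b)"
    if "\<xi> \<noteq> 0" for \<xi> v
  proof -
    have "((\<lambda>x. \<Sum>b\<in>Basis. sph_deriv b ?F x *\<^sub>R b) has_derivative
        (\<lambda>v. \<Sum>b\<in>Basis. frechet_derivative (sph_deriv b ?F) (at \<xi>) v *\<^sub>R b)) (at \<xi>)"
      by (intro has_derivative_sum has_derivative_scaleR_left smooth_punctured_has_derivative
          smooth_punctured_sph_deriv assms(1) that)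
    then have "(radial_ext (grad_S4 f) has_derivative
        (\<lambda>v. \<Sum>b\<in>Basis. frechet_derivative (sph_deriv b ?F) (at \<xi>) v *\<^sub>R b)) (at \<xi>)"
      by (rule has_derivative_transform_within_open[of _ _ _ _ "- {0}"])
        (use that radial_ext_grad_S4[OF assms(1)] in auto)
    from frechet_derivative_at[OF this, symmetric] show ?thesis
      by (simp only: diff_S4_def)
  qed
  then have "laplacian_S4 f \<xi> = (\<Sum>b\<in>Basis. frechet_derivative (sph_deriv b ?F) (at \<xi>) b)" if "\<xi> \<noteq> 0" for \<xi>
    using that by (simp add: laplacian_S4_def div_S4_def)
  then have "radial_ext (laplacian_S4 f) x
      = (\<Sum>b\<in>Basis. frechet_derivative (sph_deriv b ?F) (at (x /\<^sub>R norm x)) b)"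
    using assms(2) by (simp add: radial_ext_def)
  moreover have "frechet_derivative (sph_deriv b ?F) (at (x /\<^sub>R norm x)) b = sph_deriv b (sph_deriv b ?F) x" for b
    using frechet_derivative_scale[OF smooth_punctured_sph_deriv[OF assms(1)]
        degree_0_sph_deriv[OF assms(1) degree_0_radial_ext] assms(2), of "inverse (norm x)" b]
      assms(2) by (simp add: sph_deriv_def[of b "sph_deriv b ?F"] field_simps)
  ultimately show ?thesis by (simp add: sph_lap_def)
qed

text \<open>The Laplacian formula is used twice. Its second use requires the inner function to have
  a smooth extension, which is read off from the first use: off the origin that extension equals
  \<open>- sph_lap ?F x + 2 * ?F x\<close>.\<close>

lemma P4_S4_eq_sph_paneitz:
  assumes "smooth_punctured (radial_ext f)" "\<xi> \<in> S4"
  shows "P4_S4 f \<xi> = sph_paneitz (radial_ext f) \<xi>"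
proof -
  let ?F = "radial_ext f" and ?g = "\<lambda>\<eta>. - laplacian_S4 f \<eta> + 2 * f \<eta>"
  have g: "radial_ext ?g x = - sph_lap ?F x + 2 * ?F x" if "x \<noteq> 0" for x
    using radial_ext_laplacian_S4[OF assms(1) that] by (simp add: radial_ext_def)
  note sm = smooth_punctured_sph_paneitz_arg[OF assms(1)]
  have \<xi>: "\<xi> \<noteq> 0" using assms(2) by auto
  have "P4_S4 f \<xi> = - radial_ext (laplacian_S4 ?g) \<xi>"
    using assms(2) by (simp add: P4_S4_def radial_ext_def)
  also have "radial_ext (laplacian_S4 ?g) \<xi> = sph_lap (radial_ext ?g) \<xi>"
    by (rule radial_ext_laplacian_S4[OF smooth_punctured_cong[OF _ sm] \<xi>]) (rule g[symmetric])
  also have "\<dots> = sph_lap (\<lambda>y. - sph_lap ?F y + 2 * ?F y) \<xi>"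
    by (rule sph_lap_cong_open[of "- {0}", symmetric, OF _ _ _ sm]) (use g \<xi> in auto)
  finally show ?thesis by (simp add: sph_paneitz_def)
qed

subsection \<open>Families of functions concentrating at a point\<close>

text \<open>\<open>scaled_order p k m F\<close> says that the derivatives of order \<open>j \<le> k\<close> of \<open>F \<epsilon>\<close> are
  \<open>O (\<epsilon> powi (m - j))\<close> on the cap of radius \<open>2 * \<epsilon>\<close> at \<open>p\<close>, uniformly for small \<open>\<epsilon>\<close>.\<close>

definition cap :: "real ^ 5 \<Rightarrow> real \<Rightarrow> (real ^ 5) set" where
  "cap p \<epsilon> = {\<xi> \<in> S4. norm (\<xi> - p) < 2 * \<epsilon>}"

text \<open>The restriction \<epsilon> \<le> 1 / 4 puts the cap inside the ball of radius 1 / 2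
  about a unit vector p. This ball avoids the origin, and the Taylor bounds at p hold on it. The
  exponent is an integer because differentiation makes it negative.\<close>

definition scaled_bound :: "real ^ 5 \<Rightarrow> int \<Rightarrow> (real \<Rightarrow> real ^ 5 \<Rightarrow> real) \<Rightarrow> bool" where
  "scaled_bound p m F \<longleftrightarrow>
     (\<exists>C. \<forall>\<epsilon>. 0 < \<epsilon> \<and> \<epsilon> \<le> 1 / 4 \<longrightarrow> (\<forall>\<xi>\<in>cap p \<epsilon>. \<bar>F \<epsilon> \<xi>\<bar> \<le> C * \<epsilon> powi m))"

fun scaled_order :: "real ^ 5 \<Rightarrow> nat \<Rightarrow> int \<Rightarrow> (real \<Rightarrow> real ^ 5 \<Rightarrow> real) \<Rightarrow> bool" where
  "scaled_order p 0 m F \<longleftrightarrow> scaled_bound p m F"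
| "scaled_order p (Suc k) m F \<longleftrightarrow> scaled_bound p m F \<and>
     (\<forall>v. scaled_order p k (m - 1) (\<lambda>\<epsilon> x. frechet_derivative (F \<epsilon>) (at x) v))"

lemma cap_nonzero: "\<xi> \<in> cap p \<epsilon> \<Longrightarrow> \<xi> \<noteq> 0"
  by (auto simp: cap_def)

lemma scaled_boundI:
  "(\<And>\<epsilon> \<xi>. 0 < \<epsilon> \<Longrightarrow> \<epsilon> \<le> 1 / 4 \<Longrightarrow> \<xi> \<in> cap p \<epsilon> \<Longrightarrow> \<bar>F \<epsilon> \<xi>\<bar> \<le> C * \<epsilon> powi m) \<Longrightarrow> scaled_bound p m F"
  unfolding scaled_bound_def by blast

lemma scaled_boundE:
  assumes "scaled_bound p m F"
  obtains C where "C \<ge> 0"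
    "\<forall>\<epsilon> \<xi>. 0 < \<epsilon> \<longrightarrow> \<epsilon> \<le> 1 / 4 \<longrightarrow> \<xi> \<in> cap p \<epsilon> \<longrightarrow> \<bar>F \<epsilon> \<xi>\<bar> \<le> C * \<epsilon> powi m"
proof -
  obtain C where C: "\<And>\<epsilon> \<xi>. 0 < \<epsilon> \<Longrightarrow> \<epsilon> \<le> 1 / 4 \<Longrightarrow> \<xi> \<in> cap p \<epsilon> \<Longrightarrow> \<bar>F \<epsilon> \<xi>\<bar> \<le> C * \<epsilon> powi m"
    using assms unfolding scaled_bound_def by blast
  have "\<bar>F \<epsilon> \<xi>\<bar> \<le> \<bar>C\<bar> * \<epsilon> powi m" if "0 < \<epsilon>" "\<epsilon> \<le> 1 / 4" "\<xi> \<in> cap p \<epsilon>" for \<epsilon> \<xi>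
  proof -
    have "C * \<epsilon> powi m \<le> \<bar>C\<bar> * \<epsilon> powi m"
      using that(1) by (intro mult_right_mono) auto
    with C[OF that] show ?thesis by linarith
  qed
  then show thesis
    using that[of "\<bar>C\<bar>"] by simp
qed

lemma scaled_bound_mono:
  assumes "scaled_bound p m F" "n \<le> m"
  shows "scaled_bound p n F"
proof -
  obtain C where C0: "C \<ge> 0" and
    C: "\<forall>\<epsilon> \<xi>. 0 < \<epsilon> \<longrightarrow> \<epsilon> \<le> 1 / 4 \<longrightarrow> \<xi> \<in> cap p \<epsilon> \<longrightarrow> \<bar>F \<epsilon> \<xi>\<bar> \<le> C * \<epsilon> powi m"
    by (rule scaled_boundE[OF assms(1)])
  show ?thesis
  proof (rule scaled_boundI)
    fix \<epsilon> \<xi> assume *: "0 < \<epsilon>" "\<epsilon> \<le> 1 / 4" "\<xi> \<in> cap p \<epsilon>"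
    then have "\<epsilon> powi m \<le> \<epsilon> powi n"
      using assms(2) by (intro power_int_decreasing) auto
    then show "\<bar>F \<epsilon> \<xi>\<bar> \<le> C * \<epsilon> powi n"
      using C[rule_format, OF *] by (meson mult_left_mono C0 order_trans)
  qed
qed

lemma scaled_bound_add:
  assumes "scaled_bound p m F" "scaled_bound p m G"
  shows "scaled_bound p m (\<lambda>\<epsilon> x. F \<epsilon> x + G \<epsilon> x)"
proof -
  obtain C where "C \<ge> 0" and C: "\<forall>\<epsilon> \<xi>. 0 < \<epsilon> \<longrightarrow> \<epsilon> \<le> 1 / 4 \<longrightarrow> \<xi> \<in> cap p \<epsilon> \<longrightarrow> \<bar>F \<epsilon> \<xi>\<bar> \<le> C * \<epsilon> powi m"
    by (rule scaled_boundE[OF assms(1)])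
  obtain D where "D \<ge> 0" and D: "\<forall>\<epsilon> \<xi>. 0 < \<epsilon> \<longrightarrow> \<epsilon> \<le> 1 / 4 \<longrightarrow> \<xi> \<in> cap p \<epsilon> \<longrightarrow> \<bar>G \<epsilon> \<xi>\<bar> \<le> D * \<epsilon> powi m"
    by (rule scaled_boundE[OF assms(2)])
  show ?thesis
  proof (rule scaled_boundI)
    fix \<epsilon> \<xi> assume *: "0 < \<epsilon>" "\<epsilon> \<le> 1 / 4" "\<xi> \<in> cap p \<epsilon>"
    show "\<bar>F \<epsilon> \<xi> + G \<epsilon> \<xi>\<bar> \<le> (C + D) * \<epsilon> powi m"
      using C[rule_format, OF *] D[rule_format, OF *] abs_triangle_ineq[of "F \<epsilon> \<xi>" "G \<epsilon> \<xi>"]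
      unfolding distrib_right by linarith
  qed
qed

lemma scaled_bound_mult:
  assumes "scaled_bound p m F" "scaled_bound p n G"
  shows "scaled_bound p (m + n) (\<lambda>\<epsilon> x. F \<epsilon> x * G \<epsilon> x)"
proof -
  obtain C where C: "C \<ge> 0"
    "\<forall>\<epsilon> \<xi>. 0 < \<epsilon> \<longrightarrow> \<epsilon> \<le> 1 / 4 \<longrightarrow> \<xi> \<in> cap p \<epsilon> \<longrightarrow> \<bar>F \<epsilon> \<xi>\<bar> \<le> C * \<epsilon> powi m"
    by (rule scaled_boundE[OF assms(1)])
  obtain D where "D \<ge> 0" and D: "\<forall>\<epsilon> \<xi>. 0 < \<epsilon> \<longrightarrow> \<epsilon> \<le> 1 / 4 \<longrightarrow> \<xi> \<in> cap p \<epsilon> \<longrightarrow> \<bar>G \<epsilon> \<xi>\<bar> \<le> D * \<epsilon> powi n"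
    by (rule scaled_boundE[OF assms(2)])
  show ?thesis
  proof (rule scaled_boundI)
    fix \<epsilon> \<xi> assume *: "0 < \<epsilon>" "\<epsilon> \<le> 1 / 4" "\<xi> \<in> cap p \<epsilon>"
    have "\<bar>F \<epsilon> \<xi>\<bar> * \<bar>G \<epsilon> \<xi>\<bar> \<le> (C * \<epsilon> powi m) * (D * \<epsilon> powi n)"
      using * C(1) by (intro mult_mono C(2)[rule_format] D[rule_format]) auto
    also have "\<dots> = (C * D) * \<epsilon> powi (m + n)"
      using * by (simp add: power_int_add)
    finally show "\<bar>F \<epsilon> \<xi> * G \<epsilon> \<xi>\<bar> \<le> (C * D) * \<epsilon> powi (m + n)"
      by (simp add: abs_mult)
  qed
qed

lemma scaled_order_bound: "scaled_order p k m F \<Longrightarrow> scaled_bound p m F"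
  by (cases k) auto

lemma scaled_order_cong:
  assumes "\<And>\<epsilon> x. x \<noteq> 0 \<Longrightarrow> F \<epsilon> x = G \<epsilon> x" "\<And>\<epsilon>. smooth_punctured (F \<epsilon>)" "scaled_order p k m F"
  shows "scaled_order p k m G"
  using assms
proof (induction k arbitrary: m F G)
  have bd: "scaled_bound p m G" if "\<And>\<epsilon> x. x \<noteq> 0 \<Longrightarrow> F \<epsilon> x = G \<epsilon> x" "scaled_bound p m F" for F G m
    using that cap_nonzero unfolding scaled_bound_def by (metis (no_types, lifting))
  {
    case 0
    show ?case using bd[OF 0(1)] 0(3) by simp
  next
    case (Suc k)
    have "scaled_order p k (m - 1) (\<lambda>\<epsilon> x. frechet_derivative (G \<epsilon>) (at x) v)" for v
    proof (rule Suc.IH)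
      show "frechet_derivative (F \<epsilon>) (at x) v = frechet_derivative (G \<epsilon>) (at x) v" if "x \<noteq> 0" for \<epsilon> x
      proof -
        have "F \<epsilon> differentiable at x"
          using smooth_punctured_has_derivative[OF Suc.prems(2) that] by (auto simp: differentiable_def)
        then have "frechet_derivative (F \<epsilon>) (at x) = frechet_derivative (G \<epsilon>) (at x)"
          by (rule frechet_derivative_transform_within_open[of _ _ "- {0}"])
            (use that Suc.prems(1) in auto)
        then show ?thesis by simp
      qed
    qed (use Suc.prems in \<open>simp_all add: smooth_punctured_frechet\<close>)
    then show ?case
      using bd[OF Suc.prems(1)] Suc.prems(3) by simp
  }
qed

lemma scaled_order_mono: "scaled_order p k m F \<Longrightarrow> n \<le> m \<Longrightarrow> scaled_order p k n F"
proof (induction k arbitrary: m n F)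
  case 0
  then show ?case using scaled_bound_mono by simp
next
  case (Suc k)
  have "scaled_order p k (n - 1) (\<lambda>\<epsilon> x. frechet_derivative (F \<epsilon>) (at x) v)" for v
    by (rule Suc.IH[of "m - 1"]) (use Suc.prems in simp_all)
  moreover have "scaled_bound p n F"
    using Suc.prems by (auto intro: scaled_bound_mono[of p m])
  ultimately show ?case by simp
qed

lemma scaled_order_Suc_imp: "scaled_order p (Suc k) m F \<Longrightarrow> scaled_order p k m F"
proof (induction k arbitrary: m F)
  case (Suc k)
  have "scaled_order p k (m - 1) (\<lambda>\<epsilon> x. frechet_derivative (F \<epsilon>) (at x) v)" for v
    by (rule Suc.IH) (use Suc.prems in simp)
  then show ?case using Suc.prems by simp
qed auto

lemma scaled_order_le: "scaled_order p k m F \<Longrightarrow> j \<le> k \<Longrightarrow> scaled_order p j m F"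
  by (induction k) (metis le_Suc_eq le_zero_eq scaled_order_Suc_imp)+

lemma scaled_order_SucI:
  assumes "\<And>\<epsilon> x. x \<noteq> 0 \<Longrightarrow> (F \<epsilon> has_derivative F' \<epsilon> x) (at x)"
    and "\<And>\<epsilon> v. smooth_punctured (\<lambda>x. F' \<epsilon> x v)"
    and "\<And>v. scaled_order p k (m - 1) (\<lambda>\<epsilon> x. F' \<epsilon> x v)"
    and "scaled_bound p m F"
  shows "scaled_order p (Suc k) m F"
proof -
  have "scaled_order p k (m - 1) (\<lambda>\<epsilon> x. frechet_derivative (F \<epsilon>) (at x) v)" for v
    by (rule scaled_order_cong[OF _ assms(2) assms(3)])
      (rule fun_cong[OF frechet_derivative_at[OF assms(1)]])
  then show ?thesis using assms(4) by simp
qed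

lemma scaled_order_const:
  assumes "\<And>\<epsilon>. 0 < \<epsilon> \<Longrightarrow> \<epsilon> \<le> 1 / 4 \<Longrightarrow> \<bar>c \<epsilon>\<bar> \<le> C * \<epsilon> powi m"
  shows "scaled_order p k m (\<lambda>\<epsilon> x. c \<epsilon>)"
  using assms
proof (induction k arbitrary: c C m)
  case 0
  then show ?case using scaled_boundI[of p "\<lambda>\<epsilon> x. c \<epsilon>" C m] by simp
next
  case (Suc k)
  have "scaled_order p k (m - 1) (\<lambda>\<epsilon> x. 0)"
    by (rule Suc.IH[of _ 0]) simp
  then show ?case using Suc.prems scaled_boundI[of p "\<lambda>\<epsilon> x. c \<epsilon>" C m] by simp
qed

lemma scaled_order_add:
  assumes "\<And>\<epsilon>. smooth_punctured (F \<epsilon>)" "\<And>\<epsilon>. smooth_punctured (G \<epsilon>)"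
    and "scaled_order p k m F" "scaled_order p k m G"
  shows "scaled_order p k m (\<lambda>\<epsilon> x. F \<epsilon> x + G \<epsilon> x)"
  using assms
proof (induction k arbitrary: m F G)
  case 0
  then show ?case using scaled_bound_add by simp
next
  case (Suc k)
  note sm = Suc.prems(1,2)
  have "scaled_order p k (m - 1)
      (\<lambda>\<epsilon> x. frechet_derivative (F \<epsilon>) (at x) v + frechet_derivative (G \<epsilon>) (at x) v)" for v
    by (rule Suc.IH) (use Suc.prems in \<open>simp_all add: smooth_punctured_frechet\<close>)
  moreover have "scaled_bound p m (\<lambda>\<epsilon> x. F \<epsilon> x + G \<epsilon> x)"
    using Suc.prems scaled_bound_add by simp
  ultimately show ?case
    by (intro scaled_order_SucI[OF has_derivative_add[OF
            smooth_punctured_has_derivative[OF sm(1)] smooth_punctured_has_derivative[OF sm(2)]]]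
        smooth_punctured_add smooth_punctured_frechet sm)
qed

text \<open>Each term of the Leibniz rule differentiates one factor only, and so lowers exactly one
  of the two exponents by one.\<close>

lemma scaled_order_mult:
  assumes "\<And>\<epsilon>. smooth_punctured (F \<epsilon>)" "\<And>\<epsilon>. smooth_punctured (G \<epsilon>)"
    and "scaled_order p k m F" "scaled_order p k n G"
  shows "scaled_order p k (m + n) (\<lambda>\<epsilon> x. F \<epsilon> x * G \<epsilon> x)"
  using assms
proof (induction k arbitrary: m n F G)
  case 0
  then show ?case using scaled_bound_mult by simp
next
  case (Suc k)
  note sm = Suc.prems(1,2)
  note ord = scaled_order_Suc_imp[OF Suc.prems(3)] scaled_order_Suc_imp[OF Suc.prems(4)]
  have "scaled_order p k (m + (n - 1)) (\<lambda>\<epsilon> x. F \<epsilon> x * frechet_derivative (G \<epsilon>) (at x) v)" for v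
    by (rule Suc.IH) (use Suc.prems ord in \<open>simp_all add: smooth_punctured_frechet\<close>)
  moreover have "scaled_order p k ((m - 1) + n) (\<lambda>\<epsilon> x. frechet_derivative (F \<epsilon>) (at x) v * G \<epsilon> x)" for v
    by (rule Suc.IH) (use Suc.prems ord in \<open>simp_all add: smooth_punctured_frechet\<close>)
  ultimately have "scaled_order p k (m + n - 1)
      (\<lambda>\<epsilon> x. F \<epsilon> x * frechet_derivative (G \<epsilon>) (at x) v + frechet_derivative (F \<epsilon>) (at x) v * G \<epsilon> x)" for v
    by (intro scaled_order_add smooth_punctured_mult smooth_punctured_frechet sm)
      (simp_all add: algebra_simps)
  moreover have "scaled_bound p (m + n) (\<lambda>\<epsilon> x. F \<epsilon> x * G \<epsilon> x)"
    using Suc.prems scaled_bound_mult by simp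
  ultimately show ?case
    by (intro scaled_order_SucI[OF has_derivative_mult[OF
            smooth_punctured_has_derivative[OF sm(1)] smooth_punctured_has_derivative[OF sm(2)]]]
        smooth_punctured_add smooth_punctured_mult smooth_punctured_frechet sm)
qed

lemma scaled_order_minus:
  assumes "\<And>\<epsilon>. smooth_punctured (F \<epsilon>)" "scaled_order p k m F"
  shows "scaled_order p k m (\<lambda>\<epsilon> x. - F \<epsilon> x)"
proof -
  have "scaled_order p k (0 + m) (\<lambda>\<epsilon> x. (- 1) * F \<epsilon> x)"
    by (intro scaled_order_mult scaled_order_const[of "\<lambda>_. - 1" 1] smooth_punctured_const assms) auto
  then show ?thesis by simp
qed

lemma scaled_order_sum:
  assumes "\<And>i \<epsilon>. i \<in> I \<Longrightarrow> smooth_punctured (F i \<epsilon>)"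
    and "\<And>i. i \<in> I \<Longrightarrow> scaled_order p k m (F i)"
  shows "scaled_order p k m (\<lambda>\<epsilon> x. \<Sum>i\<in>I. F i \<epsilon> x)"
  using assms
proof (induction I rule: infinite_finite_induct)
  case (insert i I)
  then show ?case
    by (simp add: scaled_order_add smooth_punctured_sum)
qed (auto intro: scaled_order_const[of "\<lambda>_. 0" 0])

text \<open>Order 0 confines the inner values to one compact interval independent of \<epsilon>, on
  which every \<open>exp_flat P\<close> is bounded. A derivative of the composition is a derivative
  of the inner family, of order -1, times another member of the flat family; hence the induction
  over all P.\<close>

lemma scaled_order_exp_flat:
  assumes "\<And>\<epsilon>. smooth_punctured (F \<epsilon>)" "scaled_order p k 0 F"
  shows "scaled_order p k 0 (\<lambda>\<epsilon> x. exp_flat P (F \<epsilon> x))"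
  using assms(2)
proof (induction k arbitrary: P)
  have bd: "scaled_bound p 0 (\<lambda>\<epsilon> x. exp_flat P (F \<epsilon> x))" for P
  proof -
    obtain C where "C \<ge> 0" and C: "\<forall>\<epsilon> \<xi>. 0 < \<epsilon> \<longrightarrow> \<epsilon> \<le> 1 / 4 \<longrightarrow> \<xi> \<in> cap p \<epsilon> \<longrightarrow> \<bar>F \<epsilon> \<xi>\<bar> \<le> C * \<epsilon> powi 0"
      by (rule scaled_boundE[OF scaled_order_bound[OF assms(2)]])
    have "bounded (exp_flat P ` {- C..C})"
      by (intro compact_imp_bounded compact_continuous_image exp_flat_continuous) auto
    then obtain B where B: "\<forall>t\<in>{- C..C}. \<bar>exp_flat P t\<bar> \<le> B"
      unfolding bounded_iff by auto
    show ?thesis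
    proof (rule scaled_boundI)
      fix \<epsilon> \<xi> assume *: "0 < \<epsilon>" "\<epsilon> \<le> 1 / 4" "\<xi> \<in> cap p \<epsilon>"
      have "F \<epsilon> \<xi> \<in> {- C..C}"
        using C[rule_format, OF *] by auto
      then show "\<bar>exp_flat P (F \<epsilon> \<xi>)\<bar> \<le> B * \<epsilon> powi 0"
        using B by simp
    qed
  qed
  {
    case 0
    show ?case using bd by simp
  next
    case (Suc k)
    have "scaled_order p k ((0 - 1) + 0)
      (\<lambda>\<epsilon> x. frechet_derivative (F \<epsilon>) (at x) v * exp_flat ([:0, 0, 1:] * (P - pderiv P)) (F \<epsilon> x))" for v
      using Suc.prems
      by (intro scaled_order_mult Suc.IH smooth_punctured_exp_flat smooth_punctured_frechet assms(1))
        (auto simp: scaled_order_Suc_imp)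
    then show ?case
      by (intro scaled_order_SucI[OF exp_flat_compose_has_derivative[OF
              smooth_punctured_has_derivative[OF assms(1)]]]
          smooth_punctured_mult smooth_punctured_exp_flat smooth_punctured_frechet assms(1) bd)
        simp_all
  }
qed

section \<open>Orders of fixed functions from Taylor estimates at p\<close>

lemma smooth_punctured_bounded_on_compact:
  assumes "smooth_punctured G" "compact K" "0 \<notin> K"
  shows "\<exists>B\<ge>0. \<forall>x\<in>K. \<bar>G x\<bar> \<le> B"
proof -
  have "continuous_on K G"
    by (rule continuous_on_subset[OF smooth_punctured_continuous[OF assms(1)]]) (use assms(3) in auto)
  then have "bounded (G ` K)"
    using assms(2) by (intro compact_imp_bounded compact_continuous_image)
  then obtain B where "\<forall>x\<in>K. \<bar>G x\<bar> \<le> B"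
    unfolding bounded_iff by auto
  then show ?thesis
    by (intro exI[of _ "\<bar>B\<bar>"]) force
qed

text \<open>A fixed smooth function has all its derivatives bounded on the sphere, which is stronger
  than the growth permitted by a nonpositive order.\<close>

lemma scaled_order_constant_family:
  assumes "smooth_punctured G" "m \<le> 0"
  shows "scaled_order p k m (\<lambda>\<epsilon>. G)"
  using assms
proof (induction k arbitrary: G m)
  have bd: "scaled_bound p m (\<lambda>\<epsilon>. G)" if G: "smooth_punctured G" and "m \<le> 0" for G m
  proof -
    obtain B where "\<forall>x\<in>S4. \<bar>G x\<bar> \<le> B"
      using smooth_punctured_bounded_on_compact[OF G, of S4] by auto
    then have "scaled_bound p 0 (\<lambda>\<epsilon>. G)"
      by (intro scaled_boundI[of _ _ B]) (auto simp: cap_def)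
    then show ?thesis using scaled_bound_mono that(2) by blast
  qed
  {
    case 0
    then show ?case using bd by simp
  next
    case (Suc k)
    then show ?case using bd smooth_punctured_frechet by simp
  }
qed

text \<open>The factor 5 is the dimension: the operator norm of the differential is at most the sum
  of its values on the five basis vectors. As p is a unit vector, r \<le> 1 / 2 keeps the ball away
  from the origin.\<close>

lemma smooth_punctured_mvt:
  assumes "smooth_punctured H" "norm p = 1" "r \<le> 1 / 2" "x \<in> cball p r"
    and "\<And>y b. y \<in> cball p r \<Longrightarrow> b \<in> Basis \<Longrightarrow> \<bar>frechet_derivative H (at y) b\<bar> \<le> M"
  shows "\<bar>H x - H p\<bar> \<le> 5 * M * norm (x - p)"
proof -
  have nz: "y \<noteq> 0" if "y \<in> cball p r" for y
    using that assms(2,3) by (auto simp: dist_norm)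
  have "norm (H x - H p) \<le> 5 * M * norm (x - p)"
  proof (rule differentiable_bound[of "cball p r" H "\<lambda>y. frechet_derivative H (at y)"])
    fix y assume y: "y \<in> cball p r"
    have D: "(H has_derivative frechet_derivative H (at y)) (at y)"
      by (rule smooth_punctured_has_derivative[OF assms(1) nz[OF y]])
    then show "(H has_derivative frechet_derivative H (at y)) (at y within cball p r)"
      by (rule has_derivative_at_withinI)
    have "onorm (frechet_derivative H (at y)) \<le> (\<Sum>b\<in>Basis. norm (frechet_derivative H (at y) b))"
      by (rule onorm_componentwise[OF has_derivative_bounded_linear[OF D]])
    also have "\<dots> \<le> (\<Sum>b\<in>(Basis :: (real ^ 5) set). M)"
      by (rule sum_mono) (use assms(5)[OF y] in simp)
    finally show "onorm (frechet_derivative H (at y)) \<le> 5 * M" by simp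
  next
    show "p \<in> cball p r" using assms(4) by (auto intro: order_trans[OF zero_le_dist])
  qed (use assms(4) in auto)
  then show ?thesis by simp
qed

lemma smooth_punctured_vanishing_linear:
  assumes "smooth_punctured H" "norm p = 1" "H p = 0"
  shows "\<exists>C\<ge>0. \<forall>x\<in>cball p (1 / 2). \<bar>H x\<bar> \<le> C * norm (x - p)"
proof -
  have "\<exists>B\<ge>0. \<forall>x\<in>cball p (1 / 2). \<bar>frechet_derivative H (at x) b\<bar> \<le> B" for b
    by (rule smooth_punctured_bounded_on_compact[OF smooth_punctured_frechet[OF assms(1)]])
      (use assms(2) in \<open>auto simp: dist_norm\<close>)
  then obtain B where B: "\<And>b. B b \<ge> 0"
    "\<And>b. \<forall>x\<in>cball p (1 / 2). \<bar>frechet_derivative H (at x) b\<bar> \<le> B b"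
    by metis
  define M where "M = (\<Sum>b\<in>Basis. B b)"
  have M: "B b \<le> M" if "b \<in> Basis" for b
    unfolding M_def by (rule member_le_sum) (use that B(1) in auto)
  have "\<bar>H x - H p\<bar> \<le> 5 * M * norm (x - p)" if "x \<in> cball p (1 / 2)" for x
    by (rule smooth_punctured_mvt[OF assms(1,2) order_refl that])
      (use order_trans[OF B(2)[rule_format] M] in blast)
  then show ?thesis
    using assms(3) B(1) by (intro exI[of _ "5 * M"]) (simp add: M_def sum_nonneg)
qed

text \<open>Each directional derivative vanishes at p and is therefore O(|y - p|). The mean value
  bound is then applied on the ball whose radius is |x - p| itself, where the differential is O(|x -
  p|); this supplies the second factor.\<close>

lemma smooth_punctured_vanishing_quadratic:
  assumes "smooth_punctured G" "norm p = 1" "G p = 0" "\<And>v. frechet_derivative G (at p) v = 0"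
  shows "\<exists>C. \<forall>x\<in>cball p (1 / 2). \<bar>G x\<bar> \<le> C * (norm (x - p))\<^sup>2"
proof -
  have "\<exists>B\<ge>0. \<forall>x\<in>cball p (1 / 2). \<bar>frechet_derivative G (at x) b\<bar> \<le> B * norm (x - p)" for b
    by (rule smooth_punctured_vanishing_linear[OF smooth_punctured_frechet[OF assms(1)] assms(2,4)])
  then obtain B where B: "\<And>b. B b \<ge> 0"
    "\<And>b. \<forall>x\<in>cball p (1 / 2). \<bar>frechet_derivative G (at x) b\<bar> \<le> B b * norm (x - p)"
    by metis
  define M where "M = (\<Sum>b\<in>Basis. B b)"
  have M: "B b \<le> M" if "b \<in> Basis" for b
    unfolding M_def by (rule member_le_sum) (use that B(1) in auto)
  have M0: "M \<ge> 0" by (simp add: M_def sum_nonneg B(1))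
  have "\<bar>G x - G p\<bar> \<le> 5 * (M * norm (x - p)) * norm (x - p)" if x: "x \<in> cball p (1 / 2)" for x
  proof (rule smooth_punctured_mvt[OF assms(1,2), of "norm (x - p)"])
    fix y b :: "real ^ 5"
    assume y: "y \<in> cball p (norm (x - p))" and b: "b \<in> Basis"
    have "\<bar>frechet_derivative G (at y) b\<bar> \<le> B b * norm (y - p)"
      using x y by (intro B(2)[rule_format]) (auto simp: dist_norm norm_minus_commute)
    also have "\<dots> \<le> M * norm (x - p)"
      using y M[OF b] M0 by (intro mult_mono) (auto simp: dist_norm norm_minus_commute)
    finally show "\<bar>frechet_derivative G (at y) b\<bar> \<le> M * norm (x - p)" .
  qed (use x in \<open>auto simp: dist_norm norm_minus_commute\<close>)
  then show ?thesis
    using assms(3) by (intro exI[of _ "5 * M"]) (simp add: power2_eq_square mult.assoc)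
qed

text \<open>Vanishing at p only improves the undifferentiated bound. The derivatives need order 0,
  which any fixed smooth function has, so a case distinction on k replaces an induction.\<close>

lemma scaled_order_vanishing_1:
  assumes "smooth_punctured H" "norm p = 1" "H p = 0"
  shows "scaled_order p k 1 (\<lambda>\<epsilon>. H)"
proof -
  obtain C where C: "C \<ge> 0" "\<forall>x\<in>cball p (1 / 2). \<bar>H x\<bar> \<le> C * norm (x - p)"
    using smooth_punctured_vanishing_linear[OF assms] by blast
  have "scaled_bound p 1 (\<lambda>\<epsilon>. H)"
  proof (rule scaled_boundI)
    fix \<epsilon> \<xi> assume *: "0 < \<epsilon>" "\<epsilon> \<le> 1 / 4" "\<xi> \<in> cap p \<epsilon>"
    then have "\<bar>H \<xi>\<bar> \<le> C * norm (\<xi> - p)"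
      by (intro C(2)[rule_format]) (auto simp: cap_def dist_norm norm_minus_commute)
    also have "\<dots> \<le> C * (2 * \<epsilon>)"
      using * C(1) by (intro mult_left_mono) (auto simp: cap_def)
    finally show "\<bar>H \<xi>\<bar> \<le> (2 * C) * \<epsilon> powi 1" by simp
  qed
  then show ?thesis
    using scaled_order_constant_family[OF smooth_punctured_frechet[OF assms(1)], of 0]
    by (cases k) auto
qed

lemma scaled_order_vanishing_2:
  assumes "smooth_punctured G" "norm p = 1" "G p = 0" "\<And>v. frechet_derivative G (at p) v = 0"
  shows "scaled_order p k 2 (\<lambda>\<epsilon>. G)"
proof -
  obtain C where C: "\<forall>x\<in>cball p (1 / 2). \<bar>G x\<bar> \<le> C * (norm (x - p))\<^sup>2"
    using smooth_punctured_vanishing_quadratic[OF assms] by blast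
  have "scaled_bound p 2 (\<lambda>\<epsilon>. G)"
  proof (rule scaled_boundI)
    fix \<epsilon> \<xi> assume *: "0 < \<epsilon>" "\<epsilon> \<le> 1 / 4" "\<xi> \<in> cap p \<epsilon>"
    then have "\<bar>G \<xi>\<bar> \<le> C * (norm (\<xi> - p))\<^sup>2"
      by (intro C[rule_format]) (auto simp: cap_def dist_norm norm_minus_commute)
    also have "\<dots> \<le> \<bar>C\<bar> * (2 * \<epsilon>)\<^sup>2"
      using * by (intro mult_mono power_mono) (auto simp: cap_def)
    finally show "\<bar>G \<xi>\<bar> \<le> (4 * \<bar>C\<bar>) * \<epsilon> powi 2" by (simp add: power_mult_distrib)
  qed
  then show ?thesis
    using scaled_order_vanishing_1[OF smooth_punctured_frechet[OF assms(1)] assms(2,4)]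
    by (cases k) auto
qed

lemma scaled_order_sph_deriv:
  assumes "\<And>\<epsilon>. smooth_punctured (F \<epsilon>)" "scaled_order p (Suc k) m F"
  shows "scaled_order p k (m - 1) (\<lambda>\<epsilon>. sph_deriv b (F \<epsilon>))"
proof -
  have "scaled_order p k (0 + (m - 1)) (\<lambda>\<epsilon> x. norm x * frechet_derivative (F \<epsilon>) (at x) b)"
    using assms(2)
    by (intro scaled_order_mult smooth_punctured_norm smooth_punctured_frechet assms(1)
        scaled_order_constant_family) auto
  then show ?thesis by (simp add: sph_deriv_def[abs_def])
qed

lemma scaled_order_sph_lap:
  assumes "\<And>\<epsilon>. smooth_punctured (F \<epsilon>)" "scaled_order p (Suc (Suc k)) m F"
  shows "scaled_order p k (m - 2) (\<lambda>\<epsilon>. sph_lap (F \<epsilon>))"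
proof -
  have "scaled_order p k (m - 1 - 1) (\<lambda>\<epsilon>. sph_deriv b (sph_deriv b (F \<epsilon>)))" for b
    by (intro scaled_order_sph_deriv smooth_punctured_sph_deriv assms)
  then have "scaled_order p k (m - 2) (\<lambda>\<epsilon> x. \<Sum>b\<in>Basis. sph_deriv b (sph_deriv b (F \<epsilon>)) x)"
    by (intro scaled_order_sum smooth_punctured_sph_deriv assms) simp
  then show ?thesis by (simp add: sph_lap_def[abs_def])
qed

text \<open>Each Laplacian costs two orders. The zeroth-order term 2 F has the better order m, which
  is weakened to m - 2 so that the two summands can be added.\<close>

lemma scaled_bound_sph_paneitz:
  assumes "\<And>\<epsilon>. smooth_punctured (F \<epsilon>)" "scaled_order p 4 m F"
  shows "scaled_bound p (m - 4) (\<lambda>\<epsilon>. sph_paneitz (F \<epsilon>))"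
proof -
  have "scaled_order p 2 (m - 2) (\<lambda>\<epsilon>. sph_lap (F \<epsilon>))"
    using assms by (intro scaled_order_sph_lap) (auto simp: eval_nat_numeral)
  moreover have "scaled_order p 2 (m - 2) F"
    by (rule scaled_order_mono[OF scaled_order_le[OF assms(2)]]) auto
  then have "scaled_order p 2 (0 + (m - 2)) (\<lambda>\<epsilon> x. 2 * F \<epsilon> x)"
    by (intro scaled_order_mult scaled_order_const[of "\<lambda>_. 2" 2] smooth_punctured_const assms(1)) auto
  ultimately have "scaled_order p 2 (m - 2) (\<lambda>\<epsilon> y. - sph_lap (F \<epsilon>) y + 2 * F \<epsilon> y)"
    by (intro scaled_order_add scaled_order_minus smooth_punctured_minus smooth_punctured_mult
        smooth_punctured_const smooth_punctured_sph_lap assms(1)) auto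
  then have "scaled_order p 0 (m - 2 - 2) (\<lambda>\<epsilon>. sph_lap (\<lambda>y. - sph_lap (F \<epsilon>) y + 2 * F \<epsilon> y))"
    by (intro scaled_order_sph_lap smooth_punctured_sph_paneitz_arg assms(1)) (simp add: eval_nat_numeral)
  then have "scaled_order p 0 (m - 2 - 2) (\<lambda>\<epsilon> x. - sph_lap (\<lambda>y. - sph_lap (F \<epsilon>) y + 2 * F \<epsilon> y) x)"
    by (intro scaled_order_minus smooth_punctured_sph_lap smooth_punctured_sph_paneitz_arg assms(1))
  then show ?thesis by (simp add: sph_paneitz_def[abs_def])
qed

section \<open>Cutoff functions at scale \<epsilon>\<close>

definition height :: "real ^ 5 \<Rightarrow> real ^ 5 \<Rightarrow> real" where
  "height p x = 1 - (x \<bullet> p) * inverse (norm x)"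

text \<open>With \<open>k = exp_flat 1\<close>, the inner value \<open>k (1 - h / \<epsilon>\<^sup>2)\<close> is \<open>0\<close> for \<open>h \<ge> \<epsilon>\<^sup>2\<close> and at least \<open>k (1 / 2)\<close>
  for \<open>h \<le> \<epsilon>\<^sup>2 / 2\<close>, so the outer \<open>k\<close> is constant in the first case and vanishes in the second.\<close>

definition cutoff :: "real ^ 5 \<Rightarrow> real \<Rightarrow> real ^ 5 \<Rightarrow> real" where
  "cutoff p \<epsilon> x = 1 - inverse (exp_flat 1 (exp_flat 1 (1 / 2))) *
     exp_flat 1 (exp_flat 1 (1 / 2) - exp_flat 1 (1 - inverse (\<epsilon>\<^sup>2) * height p x))"

lemma height_sphere: "norm p = 1 \<Longrightarrow> \<xi> \<in> S4 \<Longrightarrow> height p \<xi> = (norm (\<xi> - p))\<^sup>2 / 2"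
  by (simp add: height_def power2_norm_eq_inner inner_diff inner_commute norm_eq_1)

lemma smooth_punctured_height: "smooth_punctured (height p)"
  unfolding height_def[abs_def]
  by (intro smooth_punctured_diff smooth_punctured_mult smooth_punctured_const
      smooth_punctured_inner smooth_punctured_inverse_norm)

text \<open>\<open>height p\<close> is one minus the cosine of the angle to p. It is minimal at p,
  so value and differential vanish there; unlike the distance to p it is also smooth at p, which
  makes it the right argument for a cutoff.\<close>

lemma scaled_order_height:
  assumes "norm p = 1"
  shows "scaled_order p k 2 (\<lambda>\<epsilon>. height p)"
proof (rule scaled_order_vanishing_2[OF smooth_punctured_height assms])
  show "height p p = 0" using assms by (simp add: height_def norm_eq_1)
  fix v
  have "p \<noteq> 0" using assms by auto
  then have "(height p has_derivative (\<lambda>v. 0)) (at p)"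
    using assms unfolding height_def[abs_def]
    by (auto intro!: derivative_eq_intros has_derivative_norm
        simp: sgn_div_norm inner_commute dot_square_norm fun_eq_iff)
  from fun_cong[OF frechet_derivative_at[OF this], of v]
  show "frechet_derivative (height p) (at p) v = 0" by simp
qed

lemma smooth_punctured_cutoff: "smooth_punctured (cutoff p \<epsilon>)"
  unfolding cutoff_def[abs_def]
  by (intro smooth_punctured_diff smooth_punctured_mult smooth_punctured_const
      smooth_punctured_exp_flat smooth_punctured_height)

text \<open>The factor \<open>inverse (\<epsilon>\<^sup>2)\<close> has order -2 and
  \<open>height p\<close> has order 2, so the rescaled height has order 0. Everything else in the
  cutoff is built from it by constants, differences and \<open>exp_flat\<close>, all of which
  preserve order 0.\<close>

lemma scaled_order_cutoff:
  assumes "norm p = 1"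
  shows "scaled_order p k 0 (cutoff p)"
proof -
  have one: "scaled_order p k 0 (\<lambda>\<epsilon> x. c)" for c
    by (rule scaled_order_const[of "\<lambda>_. c" "\<bar>c\<bar>"]) simp
  have diff: "scaled_order p k 0 (\<lambda>\<epsilon> x. c - F \<epsilon> x)"
    if "\<And>\<epsilon>. smooth_punctured (F \<epsilon>)" "scaled_order p k 0 F" for c F
    using scaled_order_add[OF smooth_punctured_const smooth_punctured_minus[OF that(1)] one
        scaled_order_minus[OF that]] by simp
  have "scaled_order p k (- 2 + 2) (\<lambda>\<epsilon> x. inverse (\<epsilon>\<^sup>2) * height p x)"
    by (intro scaled_order_mult scaled_order_height assms smooth_punctured_const
        smooth_punctured_height scaled_order_const[of _ 1]) (auto simp: power_int_minus)
  then have "scaled_order p k 0 (\<lambda>\<epsilon> x. exp_flat 1 (exp_flat 1 (1 / 2) -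
      exp_flat 1 (1 - inverse (\<epsilon>\<^sup>2) * height p x)))"
    by (intro scaled_order_exp_flat diff smooth_punctured_diff smooth_punctured_mult
        smooth_punctured_const smooth_punctured_exp_flat smooth_punctured_height) simp
  then have "scaled_order p k (0 + 0) (\<lambda>\<epsilon> x. inverse (exp_flat 1 (exp_flat 1 (1 / 2))) *
      exp_flat 1 (exp_flat 1 (1 / 2) - exp_flat 1 (1 - inverse (\<epsilon>\<^sup>2) * height p x)))"
    by (intro scaled_order_mult one smooth_punctured_diff smooth_punctured_mult
        smooth_punctured_const smooth_punctured_exp_flat smooth_punctured_height)
  then show ?thesis
    unfolding cutoff_def[abs_def]
    by (intro diff smooth_punctured_diff smooth_punctured_mult
        smooth_punctured_const smooth_punctured_exp_flat smooth_punctured_height) simp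
qed

lemma exp_flat_1: "exp_flat 1 t = (if t > 0 then exp (- 1 / t) else 0)"
  by (simp add: exp_flat_def)

lemma cutoff_eq_0:
  assumes "height p x \<ge> \<epsilon>\<^sup>2" "\<epsilon> > 0"
  shows "cutoff p \<epsilon> x = 0"
proof -
  have "1 - inverse (\<epsilon>\<^sup>2) * height p x \<le> 0"
    using assms by (simp add: field_simps)
  then show ?thesis by (simp add: cutoff_def exp_flat_1)
qed

lemma cutoff_eq_1:
  assumes "height p x \<le> \<epsilon>\<^sup>2 / 2" "\<epsilon> > 0"
  shows "cutoff p \<epsilon> x = 1"
proof -
  have *: "1 - inverse (\<epsilon>\<^sup>2) * height p x \<ge> 1 / 2"
    using assms by (simp add: field_simps)
  then have "exp_flat 1 (1 / 2) \<le> exp_flat 1 (1 - inverse (\<epsilon>\<^sup>2) * height p x)"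
    by (auto simp: exp_flat_1 field_simps)
  then have "exp_flat 1 (exp_flat 1 (1 / 2) - exp_flat 1 (1 - inverse (\<epsilon>\<^sup>2) * height p x)) = 0"
    by (simp add: exp_flat_1[of "_ - _"])
  then show ?thesis by (simp add: cutoff_def)
qed

subsection \<open>Surface measure and the Riesz kernel\<close>

lemma sets_surface_measure: "sets surface_measure = sets (restrict_space borel S4)"
  by (simp add: surface_measure_def)

lemma space_surface_measure [simp]: "space surface_measure = S4"
  using sets_eq_imp_space_eq[OF sets_surface_measure] by (simp add: space_restrict_space)

lemma sets_surface_measureI: "A \<in> sets borel \<Longrightarrow> A \<inter> S4 \<in> sets surface_measure"
  by (auto simp: sets_surface_measure sets_restrict_space)

lemma borel_measurable_surface_ident [measurable]: "(\<lambda>x. x) \<in> borel_measurable surface_measure"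
proof -
  have "(\<lambda>x. x) \<in> borel_measurable (restrict_space borel S4)"
    by (rule measurable_restrict_space1) simp
  then show ?thesis
    by (simp cong: measurable_cong_sets add: sets_surface_measure)
qed

lemma borel_measurable_surface_continuous:
  "continuous_on S4 f \<Longrightarrow> f \<in> borel_measurable surface_measure"
  using borel_measurable_continuous_on_restrict[of S4 f]
  by (simp cong: measurable_cong_sets add: sets_surface_measure)

lemma emeasure_surface_measure:
  assumes "A \<in> sets surface_measure"
  shows "emeasure surface_measure A = 5 * emeasure lborel {x \<in> cball 0 1 - {0}. x /\<^sub>R norm x \<in> A}"
proof -
  let ?B = "cball 0 1 - {0} :: (real ^ 5) set" and ?g = "\<lambda>x :: real ^ 5. x /\<^sub>R norm x"
  have g: "?g \<in> measurable (restrict_space lborel ?B) (restrict_space borel S4)"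
  proof (rule measurable_restrict_space2)
    show "?g \<in> space (restrict_space lborel ?B) \<rightarrow> S4"
      by (auto simp: space_restrict_space)
    show "?g \<in> borel_measurable (restrict_space lborel ?B)"
      by (rule measurable_restrict_space1) simp
  qed
  have "emeasure (distr (restrict_space lborel ?B) (restrict_space borel S4) ?g) A
      = emeasure (restrict_space lborel ?B) (?g -` A \<inter> ?B)"
    using emeasure_distr[OF g] assms by (simp add: sets_surface_measure space_restrict_space)
  also have "\<dots> = emeasure lborel (?g -` A \<inter> ?B)"
    by (rule emeasure_restrict_space) auto
  also have "?g -` A \<inter> ?B = {x \<in> ?B. ?g x \<in> A}" by auto
  finally show ?thesis by (simp add: surface_measure_def)
qed

lemma finite_measure_surface: "finite_measure surface_measure"
proof (rule finite_measureI)
  have "emeasure lborel {x \<in> cball 0 1 - {0}. x /\<^sub>R norm x \<in> (S4 :: (real ^ 5) set)} \<le> emeasure lborel (cball 0 1 :: (real ^ 5) set)"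
    by (rule emeasure_mono) auto
  also have "\<dots> < \<infinity>" by (simp add: emeasure_cball)
  finally have "5 * emeasure lborel {x \<in> cball 0 1 - {0}. x /\<^sub>R norm x \<in> (S4 :: (real ^ 5) set)} < \<infinity>"
    by (simp add: ennreal_mult_less_top)
  moreover have "S4 \<in> sets surface_measure"
    using sets.top[of surface_measure] by simp
  ultimately show "emeasure surface_measure (space surface_measure) \<noteq> \<infinity>"
    by (simp add: emeasure_surface_measure)
qed

interpretation surface: finite_measure surface_measure
  by (rule finite_measure_surface)

text \<open>The value is 5 * 2 * 2^5 times the volume of the unit ball: 5 normalises the surface
  measure, at most 2 / r balls are used, and their radius 2 r contributes 2^5.\<close>

definition cap_const :: real where
  "cap_const = 320 * unit_ball_vol 5"

lemma cap_const_pos: "cap_const > 0"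
  by (simp add: cap_const_def unit_ball_vol_pos)

lemma closed_cap_in_sets: "{\<eta> \<in> S4. norm (\<eta> - c) \<le> r} \<in> sets surface_measure"
proof -
  have "{\<eta> \<in> S4. norm (\<eta> - c) \<le> r} = cball c r \<inter> S4"
    by (auto simp: dist_norm norm_minus_commute)
  then show ?thesis by (simp add: sets_surface_measureI)
qed

text \<open>The cone over a cap of radius \<open>r\<close> is covered by about \<open>1 / r\<close> balls of radius \<open>2 r\<close>
  centred on its axis.\<close>

lemma emeasure_closed_cap:
  assumes "norm c = 1" "0 < r" "r \<le> 1"
  shows "emeasure surface_measure {\<eta> \<in> S4. norm (\<eta> - c) \<le> r} \<le> ennreal (cap_const * r ^ 4)"
proof -
  define N where "N = nat \<lfloor>1 / r\<rfloor>"
  let ?cone = "{x \<in> cball 0 1 - {0}. x /\<^sub>R norm x \<in> {\<eta> \<in> S4. norm (\<eta> - c) \<le> r}}"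
  have sub: "?cone \<subseteq> (\<Union>k\<le>N. cball ((real k * r) *\<^sub>R c) (2 * r))"
  proof
    fix x assume x: "x \<in> ?cone"
    \<comment> \<open>The centre is reached from x in two moves of length at most r: from x to |x|
      c, because |x| \<le> 1, and then along the axis down to a multiple of r.\<close>
    define k where "k = nat \<lfloor>norm x / r\<rfloor>"
    have "norm x / r \<le> 1 / r"
      using x assms by (intro divide_right_mono) auto
    then have "k \<le> N" unfolding k_def N_def by (intro nat_mono floor_mono)
    have "real k = of_int \<lfloor>norm x / r\<rfloor>"
      unfolding k_def using assms(2) by simp
    then have "real k \<le> norm x / r" "norm x / r < real k + 1"
      by linarith+
    then have k: "real k * r \<le> norm x" "norm x < real k * r + r"
      using assms(2) by (simp_all add: field_simps)
    have "norm (x - norm x *\<^sub>R c) = norm (norm x *\<^sub>R (x /\<^sub>R norm x - c))"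
      using x by (simp add: scaleR_diff_right)
    also have "\<dots> \<le> 1 * r"
      unfolding norm_scaleR using x by (intro mult_mono) auto
    finally have 1: "norm (x - norm x *\<^sub>R c) \<le> r" by simp
    have "norm (norm x *\<^sub>R c - (real k * r) *\<^sub>R c) = \<bar>norm x - real k * r\<bar>"
      using assms(1) by (simp flip: scaleR_diff_left)
    then have 2: "norm (norm x *\<^sub>R c - (real k * r) *\<^sub>R c) \<le> r"
      using k by simp
    have "norm (x - (real k * r) *\<^sub>R c) \<le> 2 * r"
      using norm_triangle_ineq[of "x - norm x *\<^sub>R c" "norm x *\<^sub>R c - (real k * r) *\<^sub>R c"] 1 2 by simp
    then show "x \<in> (\<Union>k\<le>N. cball ((real k * r) *\<^sub>R c) (2 * r))"
      using \<open>k \<le> N\<close> by (auto simp: dist_norm norm_minus_commute)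
  qed
  have "emeasure lborel ?cone \<le> emeasure lborel (\<Union>k\<le>N. cball ((real k * r) *\<^sub>R c) (2 * r))"
    by (rule emeasure_mono[OF sub]) auto
  also have "\<dots> \<le> (\<Sum>k\<le>N. emeasure lborel (cball ((real k * r) *\<^sub>R c) (2 * r)))"
    by (rule emeasure_subadditive_finite) auto
  also have "\<dots> = (\<Sum>k\<le>N. ennreal (unit_ball_vol 5 * (2 * r) ^ 5))"
    using assms(2) by (simp add: emeasure_cball)
  also have "\<dots> = ennreal (real (Suc N) * (unit_ball_vol 5 * (2 * r) ^ 5))"
    by (subst ennreal_mult) (use assms(2) in \<open>auto simp: ennreal_of_nat_eq_real_of_nat\<close>)
  also have "\<dots> \<le> ennreal (2 / r * (unit_ball_vol 5 * (2 * r) ^ 5))"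
  proof (intro ennreal_leI mult_right_mono)
    have "1 / r \<ge> 1" using assms by simp
    moreover have "real N \<le> 1 / r"
      unfolding N_def using assms(2) by simp
    ultimately show "real (Suc N) \<le> 2 / r" by simp
  qed (use assms(2) in simp)
  also have "2 / r * (unit_ball_vol 5 * (2 * r) ^ 5) = 64 * unit_ball_vol 5 * r ^ 4"
    using assms(2) by (simp add: power_mult_distrib eval_nat_numeral)
  finally have "5 * emeasure lborel ?cone \<le> 5 * ennreal (64 * unit_ball_vol 5 * r ^ 4)"
    by (rule mult_left_mono) simp
  also have "\<dots> = ennreal (5 * (64 * unit_ball_vol 5 * r ^ 4))"
    by (subst ennreal_mult) auto
  finally show ?thesis
    unfolding emeasure_surface_measure[OF closed_cap_in_sets] cap_const_def by (simp add: mult.assoc)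
qed

section \<open>Uniform integrability of the Riesz kernel\<close>

lemma dyadic_between:
  assumes "0 < d" "d \<le> (1 :: real)"
  obtains k where "(1 / 2) ^ Suc k < d" "d \<le> (1 / 2) ^ k"
proof -
  obtain n :: nat where "(1 / 2) ^ n < d"
    using real_arch_pow_inv[OF assms(1), of "1 / 2"] by auto
  then have ex: "(1 / 2) ^ Suc n < d"
    by (intro order.strict_trans1[OF power_decreasing[of n "Suc n"]]) auto
  define k where "k = (LEAST k. (1 / 2 :: real) ^ Suc k < d)"
  have k: "(1 / 2) ^ Suc k < d"
    unfolding k_def by (rule LeastI[of "\<lambda>k. (1 / 2) ^ Suc k < d", OF ex])
  have "d \<le> (1 / 2) ^ k"
  proof (cases k)
    case (Suc j)
    then have "\<not> (1 / 2 :: real) ^ Suc j < d"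
      using not_less_Least[of j "\<lambda>k. (1 / 2 :: real) ^ Suc k < d"] unfolding k_def by simp
    then show ?thesis using Suc by simp
  qed (use assms in simp)
  with k show thesis by (rule that)
qed

text \<open>On the shell 2^(-k-1) < |\<xi> - \<eta>| \<le> 2^(-k) the kernel is at most 2^(\<alpha>
  (k+1)). The summand 1 takes care of distances greater than 1. Using full caps instead of shells
  only enlarges the right-hand side.\<close>

lemma riesz_kernel_le_dyadic:
  assumes "\<alpha> > 0" "\<eta> \<in> S4"
  shows "ennreal (norm (\<xi> - \<eta>) powr (- \<alpha>)) \<le> 1 + (\<Sum>k. ennreal (2 powr (\<alpha> * real (Suc k))) *
    indicator {\<eta> \<in> S4. norm (\<eta> - \<xi>) \<le> (1 / 2) ^ k} \<eta>)" (is "_ \<le> 1 + suminf ?f")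
proof -
  let ?d = "norm (\<xi> - \<eta>)"
  consider "?d = 0" | "?d > 1" | "0 < ?d" "?d \<le> 1" by force
  then show ?thesis
  proof cases
    \<comment> \<open>On the diagonal the kernel is 0, as \<open>powr\<close> with base 0 yields
      0.\<close>
    case 1
    then show ?thesis by simp
  next
    case 2
    then have "?d powr (- \<alpha>) \<le> 1"
      using powr_mono[of "- \<alpha>" 0 ?d] assms(1) by (simp split: if_splits)
    then have "ennreal (?d powr (- \<alpha>)) \<le> 1" by simp
    also have "\<dots> \<le> 1 + suminf ?f" by simp
    finally show ?thesis .
  next
    case 3
    obtain k where k: "(1 / 2) ^ Suc k < ?d" "?d \<le> (1 / 2) ^ k"
      by (rule dyadic_between[OF 3])
    have "?d powr (- \<alpha>) \<le> ((1 / 2) ^ Suc k) powr (- \<alpha>)"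
      using assms(1) k by (intro powr_mono2') auto
    also have "(1 / 2 :: real) ^ Suc k = 2 powr (- real (Suc k))"
      by (simp add: powr_minus powr_realpow field_simps del: power_Suc of_nat_Suc)
    also have "\<dots> powr (- \<alpha>) = 2 powr (\<alpha> * real (Suc k))"
      by (simp only: powr_powr minus_mult_minus mult.commute)
    finally have "ennreal (?d powr (- \<alpha>)) \<le> ?f k"
      using k(2) assms(2) by (simp add: norm_minus_commute ennreal_leI)
    also have "?f k \<le> 1 + suminf ?f"
    proof -
      have "g k \<le> 1 + suminf g" for g :: "nat \<Rightarrow> ennreal"
        using sum_le_suminf[of g "{k}"] by (simp add: add_increasing)
      then show ?thesis .
    qed
    finally show ?thesis .
  qed
qed

text \<open>The k-th dyadic term is at most 2^(\<alpha> (k+1)) times \<open>cap_const\<close> times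
  2^(-4 k). This is a geometric series of ratio 2^(\<alpha> - 4), convergent because \<alpha> < 4.
  The bound is uniform in \<xi> since the cap estimate depends on the radius alone.\<close>

lemma nn_integral_riesz_kernel_bound:
  assumes "0 < \<alpha>" "\<alpha> < 4"
  shows "\<exists>K\<ge>0. \<forall>\<xi>\<in>S4. (\<integral>\<^sup>+\<eta>. ennreal (norm (\<xi> - \<eta>) powr (- \<alpha>)) \<partial>surface_measure) \<le> ennreal K"
proof -
  define q where "q = 2 powr (\<alpha> - 4)"
  have q: "0 < q" "q < 1"
    using assms powr_less_mono[of "\<alpha> - 4" 0 2] by (simp_all add: q_def)
  let ?t = "\<lambda>k. (2 powr \<alpha> * cap_const) * q ^ k"
  have sum: "summable ?t"
    using q by (intro summable_mult summable_geometric) simp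
  have t: "?t k \<ge> 0" for k
    using q cap_const_pos by simp
  define K where "K = measure surface_measure S4 + suminf ?t"
  have "(\<integral>\<^sup>+\<eta>. ennreal (norm (\<xi> - \<eta>) powr (- \<alpha>)) \<partial>surface_measure) \<le> ennreal K" if \<xi>: "\<xi> \<in> S4" for \<xi>
  proof -
    let ?B = "\<lambda>k. {\<eta> \<in> S4. norm (\<eta> - \<xi>) \<le> (1 / 2 :: real) ^ k}"
    have "(\<integral>\<^sup>+\<eta>. ennreal (norm (\<xi> - \<eta>) powr (- \<alpha>)) \<partial>surface_measure)
        \<le> (\<integral>\<^sup>+\<eta>. 1 + (\<Sum>k. ennreal (2 powr (\<alpha> * real (Suc k))) * indicator (?B k) \<eta>) \<partial>surface_measure)"
      by (rule nn_integral_mono) (use riesz_kernel_le_dyadic[OF assms(1)] in simp)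
    also have "\<dots> = emeasure surface_measure S4 +
        (\<Sum>k. ennreal (2 powr (\<alpha> * real (Suc k))) * emeasure surface_measure (?B k))"
    proof -
      have "(\<integral>\<^sup>+\<eta>. 1 + (\<Sum>k. c k * indicator (A k) \<eta>) \<partial>surface_measure)
          = emeasure surface_measure S4 + (\<Sum>k. c k * emeasure surface_measure (A k))"
        if [measurable]: "\<And>k. A k \<in> sets surface_measure" for c :: "nat \<Rightarrow> ennreal" and A
        by (subst nn_integral_add) (simp_all add: nn_integral_suminf nn_integral_cmult_indicator)
      from this[of ?B "\<lambda>k. ennreal (2 powr (\<alpha> * real (Suc k)))", OF closed_cap_in_sets]
      show ?thesis .
    qed
    also have "\<dots> \<le> emeasure surface_measure S4 + (\<Sum>k. ennreal (?t k))"
    proof (intro add_left_mono suminf_le summableI)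
      fix k
      have "emeasure surface_measure (?B k) \<le> ennreal (cap_const * ((1 / 2) ^ k) ^ 4)"
        by (rule emeasure_closed_cap) (use \<xi> in \<open>auto simp: power_le_one\<close>)
      then have "ennreal (2 powr (\<alpha> * real (Suc k))) * emeasure surface_measure (?B k)
          \<le> ennreal (2 powr (\<alpha> * real (Suc k))) * ennreal (cap_const * ((1 / 2) ^ k) ^ 4)"
        by (rule mult_left_mono) simp
      also have "\<dots> = ennreal (2 powr (\<alpha> * real (Suc k)) * (cap_const * ((1 / 2) ^ k) ^ 4))"
        by (rule ennreal_mult[symmetric]) (use cap_const_pos in auto)
      also have "2 powr (\<alpha> * real (Suc k)) * (cap_const * ((1 / 2) ^ k) ^ 4) = ?t k"
      proof -
        have "(1 / 2 :: real) ^ k = 2 powr (- real k)"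
          by (simp add: powr_minus powr_realpow field_simps)
        then have "((1 / 2 :: real) ^ k) ^ 4 = 2 powr (- 4 * real k)"
          by (simp add: powr_power)
        moreover have "q ^ k = 2 powr ((\<alpha> - 4) * real k)"
          by (simp add: q_def powr_power mult.commute)
        ultimately show ?thesis
          by (simp add: powr_add[symmetric] algebra_simps)
      qed
      finally show "ennreal (2 powr (\<alpha> * real (Suc k))) * emeasure surface_measure (?B k) \<le> ennreal (?t k)" .
    qed
    also have "(\<Sum>k. ennreal (?t k)) = ennreal (suminf ?t)"
      using t sum by (intro suminf_ennreal2) auto
    also have "emeasure surface_measure S4 + ennreal (suminf ?t) = ennreal K"
      by (simp add: K_def surface.emeasure_eq_measure suminf_nonneg[OF sum t])
    finally show ?thesis .
  qed
  moreover have "K \<ge> 0" by (simp add: K_def suminf_nonneg[OF sum t])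
  ultimately show ?thesis by blast
qed

lemma riesz_kernel_integrable:
  assumes "0 < \<alpha>" "\<alpha> < 4"
  shows "\<exists>K\<ge>0. \<forall>\<xi>\<in>S4. integrable surface_measure (\<lambda>\<eta>. norm (\<xi> - \<eta>) powr (- \<alpha>)) \<and> mu0 \<alpha> \<xi> \<le> K"
proof -
  obtain K where K: "K \<ge> 0"
    "\<forall>\<xi>\<in>S4. (\<integral>\<^sup>+\<eta>. ennreal (norm (\<xi> - \<eta>) powr (- \<alpha>)) \<partial>surface_measure) \<le> ennreal K"
    using nn_integral_riesz_kernel_bound[OF assms] by blast
  have "integrable surface_measure (\<lambda>\<eta>. norm (\<xi> - \<eta>) powr (- \<alpha>)) \<and> mu0 \<alpha> \<xi> \<le> K" if "\<xi> \<in> S4" for \<xi>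
  proof -
    have I: "integrable surface_measure (\<lambda>\<eta>. norm (\<xi> - \<eta>) powr (- \<alpha>))"
    proof (rule integrableI_nonneg)
      show "(\<integral>\<^sup>+\<eta>. ennreal (norm (\<xi> - \<eta>) powr (- \<alpha>)) \<partial>surface_measure) < \<infinity>"
        using le_less_trans[OF K(2)[rule_format, OF that] ennreal_less_top] by simp
    qed simp_all
    then have "ennreal (mu0 \<alpha> \<xi>) \<le> ennreal K"
      using K(2)[rule_format, OF that] nn_integral_eq_integral[OF I] by (simp add: mu0_def)
    with I K(1) show ?thesis by simp
  qed
  with K(1) show ?thesis by blast
qed

lemma borel_measurable_R_op:
  assumes [measurable]: "f \<in> borel_measurable surface_measure"
  shows "R_op \<alpha> f \<in> borel_measurable surface_measure"
proof -
  have "(\<lambda>(\<xi>, \<eta>). norm (\<xi> - \<eta>) powr (- \<alpha>) * f \<eta>)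
      \<in> borel_measurable (surface_measure \<Otimes>\<^sub>M surface_measure)"
    by measurable
  then show ?thesis
    unfolding R_op_def[abs_def] by (rule surface.borel_measurable_lebesgue_integral)
qed

lemma mu0_eq_R_op: "mu0 \<alpha> = R_op \<alpha> (\<lambda>_. 1)"
  by (simp add: mu0_def R_op_def fun_eq_iff)

lemma R_op_integrable:
  assumes "0 < \<alpha>" "\<alpha> < 4" "\<xi> \<in> S4" "f \<in> borel_measurable surface_measure"
    and "\<And>\<eta>. \<eta> \<in> S4 \<Longrightarrow> \<bar>f \<eta>\<bar> \<le> B"
  shows "integrable surface_measure (\<lambda>\<eta>. norm (\<xi> - \<eta>) powr (- \<alpha>) * f \<eta>)"
    and "\<bar>R_op \<alpha> f \<xi>\<bar> \<le> B * mu0 \<alpha> \<xi>"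
proof -
  have I: "integrable surface_measure (\<lambda>\<eta>. B * norm (\<xi> - \<eta>) powr (- \<alpha>))"
    using riesz_kernel_integrable[OF assms(1,2)] assms(3) by auto
  have le: "norm (norm (\<xi> - \<eta>) powr (- \<alpha>) * f \<eta>) \<le> B * norm (\<xi> - \<eta>) powr (- \<alpha>)" if "\<eta> \<in> S4" for \<eta>
    using mult_left_mono[OF assms(5)[OF that], of "norm (\<xi> - \<eta>) powr (- \<alpha>)"]
    by (simp add: abs_mult mult.commute)
  show int: "integrable surface_measure (\<lambda>\<eta>. norm (\<xi> - \<eta>) powr (- \<alpha>) * f \<eta>)"
  proof (rule Bochner_Integration.integrable_bound[OF I])
    show "(\<lambda>\<eta>. norm (\<xi> - \<eta>) powr (- \<alpha>) * f \<eta>) \<in> borel_measurable surface_measure"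
      using assms(4) by measurable
    show "AE \<eta> in surface_measure. norm (norm (\<xi> - \<eta>) powr (- \<alpha>) * f \<eta>) \<le> norm (B * norm (\<xi> - \<eta>) powr (- \<alpha>))"
      using order_trans[OF le abs_ge_self] by (intro AE_I2) simp
  qed
  have "norm (R_op \<alpha> f \<xi>) \<le> (LINT \<eta>|surface_measure. B * norm (\<xi> - \<eta>) powr (- \<alpha>))"
    unfolding R_op_def
    by (rule Bochner_Integration.integral_norm_bound_integral[OF int I]) (use le in simp)
  then show "\<bar>R_op \<alpha> f \<xi>\<bar> \<le> B * mu0 \<alpha> \<xi>" by (simp add: mu0_def)
qed

subsection \<open>The distribution at the singular point\<close>

lemma smooth_S4_iff: "smooth_S4 f \<longleftrightarrow> smooth_punctured (radial_ext f)"
  by (simp add: smooth_S4_def smooth_punctured_def)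

lemma radial_ext_sphere: "\<xi> \<in> S4 \<Longrightarrow> radial_ext f \<xi> = f \<xi>"
  by (simp add: radial_ext_def)

lemma radial_ext_add_cmult:
  "radial_ext (\<lambda>x. f x + c * g x) = (\<lambda>x. radial_ext f x + c * radial_ext g x)"
  by (simp add: radial_ext_def fun_eq_iff)

lemma smooth_S4_add_cmult: "smooth_S4 f \<Longrightarrow> smooth_S4 g \<Longrightarrow> smooth_S4 (\<lambda>x. f x + c * g x)"
  by (simp add: smooth_S4_iff radial_ext_add_cmult smooth_punctured_add smooth_punctured_mult
      smooth_punctured_const)

lemma smooth_S4_sum:
  "(\<And>j. j \<in> J \<Longrightarrow> smooth_S4 (g j)) \<Longrightarrow> smooth_S4 f \<Longrightarrow> smooth_S4 (\<lambda>x. f x + (\<Sum>j\<in>J. c j * g j x))"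
proof (induction J rule: infinite_finite_induct)
  case (insert i J)
  then have "smooth_S4 (\<lambda>x. (f x + (\<Sum>j\<in>J. c j * g j x)) + c i * g i x)"
    by (intro smooth_S4_add_cmult) auto
  then show ?case using insert.hyps by (simp add: algebra_simps)
qed auto

lemma smooth_S4_const: "smooth_S4 (\<lambda>x. c)"
  by (simp add: smooth_S4_iff radial_ext_def[abs_def] smooth_punctured_const)

lemma smooth_S4_inner: "smooth_S4 (\<lambda>x. x \<bullet> a)"
proof -
  have "radial_ext (\<lambda>x. x \<bullet> a) = (\<lambda>x. inverse (norm x) * (x \<bullet> a))"
    by (simp add: radial_ext_def fun_eq_iff)
  then show ?thesis
    by (simp add: smooth_S4_iff smooth_punctured_mult smooth_punctured_inverse_norm smooth_punctured_inner)
qed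

lemma smooth_punctured_continuous_S4: "smooth_punctured F \<Longrightarrow> continuous_on S4 F"
  by (rule continuous_on_subset[OF smooth_punctured_continuous]) auto

lemma smooth_S4_measurable_bounded:
  assumes "smooth_S4 \<psi>"
  shows "\<psi> \<in> borel_measurable surface_measure" "\<exists>B\<ge>0. \<forall>\<xi>\<in>S4. \<bar>\<psi> \<xi>\<bar> \<le> B"
proof -
  have F: "smooth_punctured (radial_ext \<psi>)" using assms by (simp add: smooth_S4_iff)
  have "continuous_on S4 \<psi>"
    by (rule continuous_on_eq[OF smooth_punctured_continuous_S4[OF F] radial_ext_sphere])
  then show "\<psi> \<in> borel_measurable surface_measure"
    by (rule borel_measurable_surface_continuous)
  show "\<exists>B\<ge>0. \<forall>\<xi>\<in>S4. \<bar>\<psi> \<xi>\<bar> \<le> B"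
    using smooth_punctured_bounded_on_compact[OF F, of S4] by (simp add: radial_ext_def)
qed

lemma P4_S4_measurable_bounded:
  assumes "smooth_S4 \<psi>"
  shows "P4_S4 \<psi> \<in> borel_measurable surface_measure" "\<exists>B\<ge>0. \<forall>\<xi>\<in>S4. \<bar>P4_S4 \<psi> \<xi>\<bar> \<le> B"
proof -
  have F: "smooth_punctured (radial_ext \<psi>)" using assms by (simp add: smooth_S4_iff)
  note P = smooth_punctured_sph_paneitz[OF F] and eq = P4_S4_eq_sph_paneitz[OF F]
  have "continuous_on S4 (P4_S4 \<psi>)"
    by (rule continuous_on_eq[OF smooth_punctured_continuous_S4[OF P] eq[symmetric]])
  then show "P4_S4 \<psi> \<in> borel_measurable surface_measure"
    by (rule borel_measurable_surface_continuous)
  show "\<exists>B\<ge>0. \<forall>\<xi>\<in>S4. \<bar>P4_S4 \<psi> \<xi>\<bar> \<le> B"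
    using smooth_punctured_bounded_on_compact[OF P, of S4] eq by simp
qed

lemma L_op_measurable:
  assumes "smooth_S4 \<psi>"
  shows "L_op \<alpha> \<psi> \<in> borel_measurable surface_measure"
proof -
  note [measurable] = smooth_S4_measurable_bounded(1)[OF assms] P4_S4_measurable_bounded(1)[OF assms]
    borel_measurable_R_op
  show ?thesis
    unfolding L_op_def[abs_def] mu0_eq_R_op by measurable
qed

text \<open>K is chosen before \<psi>, so that one constant serves the whole family of truncated
  functions as \<epsilon> varies.\<close>

lemma nonlocal_part_bound:
  assumes "0 < \<alpha>" "\<alpha> < 4"
  shows "\<exists>K\<ge>0. \<forall>\<psi> B. smooth_S4 \<psi> \<longrightarrow> (\<forall>\<xi>\<in>S4. \<bar>\<psi> \<xi>\<bar> \<le> B) \<longrightarrow>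
    (\<forall>\<xi>\<in>S4. \<bar>kappa \<alpha> * (R_op \<alpha> \<psi> \<xi> + mu0 \<alpha> \<xi> * \<psi> \<xi>)\<bar> \<le> K * B)"
proof -
  obtain K where K: "K \<ge> 0" "\<forall>\<xi>\<in>S4. integrable surface_measure (\<lambda>\<eta>. norm (\<xi> - \<eta>) powr (- \<alpha>)) \<and> mu0 \<alpha> \<xi> \<le> K"
    using riesz_kernel_integrable[OF assms] by blast
  have "\<bar>kappa \<alpha> * (R_op \<alpha> \<psi> \<xi> + mu0 \<alpha> \<xi> * \<psi> \<xi>)\<bar> \<le> (\<bar>kappa \<alpha>\<bar> * (2 * K)) * B"
    if \<psi>: "smooth_S4 \<psi>" "\<forall>\<xi>\<in>S4. \<bar>\<psi> \<xi>\<bar> \<le> B" and \<xi>: "\<xi> \<in> S4" for \<psi> B \<xi>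
  proof -
    have B: "B \<ge> 0" using \<psi>(2) \<xi> abs_ge_zero order_trans by blast
    have mu: "0 \<le> mu0 \<alpha> \<xi>" "mu0 \<alpha> \<xi> \<le> K"
      using K(2) \<xi> by (auto simp: mu0_def)
    have "\<bar>R_op \<alpha> \<psi> \<xi>\<bar> \<le> B * mu0 \<alpha> \<xi>"
      by (rule R_op_integrable(2)[OF assms \<xi> smooth_S4_measurable_bounded(1)[OF \<psi>(1)]]) (use \<psi>(2) in blast)
    also have "\<dots> \<le> B * K" using mu B by (intro mult_left_mono)
    finally have R: "\<bar>R_op \<alpha> \<psi> \<xi>\<bar> \<le> B * K" .
    have "\<bar>mu0 \<alpha> \<xi> * \<psi> \<xi>\<bar> \<le> K * B"
      unfolding abs_mult using mu \<psi>(2) \<xi> K(1) by (intro mult_mono) auto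
    with R have "\<bar>R_op \<alpha> \<psi> \<xi> + mu0 \<alpha> \<xi> * \<psi> \<xi>\<bar> \<le> 2 * K * B"
      using abs_triangle_ineq[of "R_op \<alpha> \<psi> \<xi>" "mu0 \<alpha> \<xi> * \<psi> \<xi>"] by (simp add: mult.commute)
    then have "\<bar>kappa \<alpha>\<bar> * \<bar>R_op \<alpha> \<psi> \<xi> + mu0 \<alpha> \<xi> * \<psi> \<xi>\<bar> \<le> \<bar>kappa \<alpha>\<bar> * (2 * K * B)"
      by (rule mult_left_mono) simp
    then show ?thesis by (simp add: abs_mult mult.assoc)
  qed
  with K(1) show ?thesis
    by (intro exI[of _ "\<bar>kappa \<alpha>\<bar> * (2 * K)"]) simp
qed

lemma L_op_bounded:
  assumes "0 < \<alpha>" "\<alpha> < 4" "smooth_S4 \<psi>"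
  shows "\<exists>B\<ge>0. \<forall>\<xi>\<in>S4. \<bar>L_op \<alpha> \<psi> \<xi>\<bar> \<le> B"
proof -
  obtain B where B: "B \<ge> 0" "\<forall>\<xi>\<in>S4. \<bar>\<psi> \<xi>\<bar> \<le> B"
    using smooth_S4_measurable_bounded(2)[OF assms(3)] by blast
  obtain D where D: "D \<ge> 0" "\<forall>\<xi>\<in>S4. \<bar>P4_S4 \<psi> \<xi>\<bar> \<le> D"
    using P4_S4_measurable_bounded(2)[OF assms(3)] by blast
  obtain K where K: "K \<ge> 0" "\<forall>\<psi> B. smooth_S4 \<psi> \<longrightarrow> (\<forall>\<xi>\<in>S4. \<bar>\<psi> \<xi>\<bar> \<le> B) \<longrightarrow>
    (\<forall>\<xi>\<in>S4. \<bar>kappa \<alpha> * (R_op \<alpha> \<psi> \<xi> + mu0 \<alpha> \<xi> * \<psi> \<xi>)\<bar> \<le> K * B)"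
    using nonlocal_part_bound[OF assms(1,2)] by blast
  have "\<bar>L_op \<alpha> \<psi> \<xi>\<bar> \<le> D + K * B" if "\<xi> \<in> S4" for \<xi>
    using K(2)[rule_format, OF assms(3) B(2)[rule_format] that] D(2)[rule_format, OF that]
    unfolding L_op_def by linarith
  then show ?thesis
    using B(1) D(1) K(1) by (intro exI[of _ "D + K * B"]) simp
qed

section \<open>The pairing with \<Phi>: integrability and linearity\<close>

lemma square_integrable_imp_integrable:
  assumes "square_integrable_S4 \<Phi>"
  shows "integrable surface_measure \<Phi>"
proof (rule Bochner_Integration.integrable_bound)
  show "integrable surface_measure (\<lambda>\<xi>. 1 + (\<Phi> \<xi>)\<^sup>2)"
    using assms by (simp add: square_integrable_S4_def)
  have "\<bar>x\<bar> \<le> 1 + x\<^sup>2" for x :: real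
    using zero_le_power2[of "\<bar>x\<bar> - 1 / 2"] by (simp add: power2_eq_square algebra_simps)
  then show "AE \<xi> in surface_measure. norm (\<Phi> \<xi>) \<le> norm (1 + (\<Phi> \<xi>)\<^sup>2)"
    by (intro AE_I2) (simp add: order_trans[OF _ abs_ge_self])
qed (use assms in \<open>simp add: square_integrable_S4_def\<close>)

lemma L_distr_integrable:
  assumes "0 < \<alpha>" "\<alpha> < 4" "square_integrable_S4 \<Phi>" "smooth_S4 \<psi>"
  shows "integrable surface_measure (\<lambda>\<xi>. \<Phi> \<xi> * L_op \<alpha> \<psi> \<xi>)"
proof -
  obtain B where B: "B \<ge> 0" "\<forall>\<xi>\<in>S4. \<bar>L_op \<alpha> \<psi> \<xi>\<bar> \<le> B"
    using L_op_bounded[OF assms(1,2,4)] by blast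
  note [measurable] = L_op_measurable[OF assms(4)]
  have [measurable]: "\<Phi> \<in> borel_measurable surface_measure"
    using assms(3) by (simp add: square_integrable_S4_def)
  show ?thesis
  proof (rule Bochner_Integration.integrable_bound)
    show "integrable surface_measure (\<lambda>\<xi>. \<Phi> \<xi> * B)"
      using square_integrable_imp_integrable[OF assms(3)] by simp
    have "norm (\<Phi> \<xi> * L_op \<alpha> \<psi> \<xi>) \<le> norm (\<Phi> \<xi> * B)" if "\<xi> \<in> S4" for \<xi>
      using B that by (auto simp: abs_mult intro: mult_left_mono)
    then show "AE \<xi> in surface_measure. norm (\<Phi> \<xi> * L_op \<alpha> \<psi> \<xi>) \<le> norm (\<Phi> \<xi> * B)"
      by (intro AE_I2) simp
  qed measurable
qed

lemma L_op_add_cmult: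
  assumes "0 < \<alpha>" "\<alpha> < 4" "smooth_S4 f" "smooth_S4 g" "\<xi> \<in> S4"
  shows "L_op \<alpha> (\<lambda>x. f x + c * g x) \<xi> = L_op \<alpha> f \<xi> + c * L_op \<alpha> g \<xi>"
proof -
  have "\<xi> \<noteq> 0" using assms(5) by auto
  then have "P4_S4 (\<lambda>x. f x + c * g x) \<xi> = P4_S4 f \<xi> + c * P4_S4 g \<xi>"
    using assms smooth_S4_add_cmult[OF assms(3,4), of c]
    by (simp add: P4_S4_eq_sph_paneitz smooth_S4_iff radial_ext_add_cmult sph_paneitz_add_cmult)
  moreover have "integrable surface_measure (\<lambda>\<eta>. norm (\<xi> - \<eta>) powr (- \<alpha>) * h \<eta>)" if "smooth_S4 h" for h
    using smooth_S4_measurable_bounded[OF that] R_op_integrable(1)[OF assms(1,2,5)] by blast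
  then have "R_op \<alpha> (\<lambda>x. f x + c * g x) \<xi> = R_op \<alpha> f \<xi> + c * R_op \<alpha> g \<xi>"
    using assms(3,4) by (simp add: R_op_def distrib_left mult.left_commute[of _ c])
  ultimately show ?thesis by (simp add: L_op_def algebra_simps)
qed

lemma L_distr_add_cmult:
  assumes "0 < \<alpha>" "\<alpha> < 4" "square_integrable_S4 \<Phi>" "smooth_S4 f" "smooth_S4 g"
  shows "L_distr \<alpha> \<Phi> (\<lambda>x. f x + c * g x) = L_distr \<alpha> \<Phi> f + c * L_distr \<alpha> \<Phi> g"
proof -
  have "L_distr \<alpha> \<Phi> (\<lambda>x. f x + c * g x)
      = (LINT \<xi>|surface_measure. \<Phi> \<xi> * L_op \<alpha> f \<xi> + c * (\<Phi> \<xi> * L_op \<alpha> g \<xi>))"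
    unfolding L_distr_def
    by (rule Bochner_Integration.integral_cong[OF refl])
      (simp add: L_op_add_cmult assms algebra_simps)
  then show ?thesis
    using L_distr_integrable[OF assms(1-4)] L_distr_integrable[OF assms(1-3,5)]
    by (simp add: L_distr_def)
qed

lemma L_distr_sum:
  assumes "0 < \<alpha>" "\<alpha> < 4" "square_integrable_S4 \<Phi>"
    and "\<And>j. j \<in> J \<Longrightarrow> smooth_S4 (g j)" "smooth_S4 f"
  shows "L_distr \<alpha> \<Phi> (\<lambda>x. f x + (\<Sum>j\<in>J. c j * g j x)) = L_distr \<alpha> \<Phi> f + (\<Sum>j\<in>J. c j * L_distr \<alpha> \<Phi> (g j))"
  using assms(4)
proof (induction J rule: infinite_finite_induct)
  case (insert i J)
  have "L_distr \<alpha> \<Phi> (\<lambda>x. (f x + (\<Sum>j\<in>J. c j * g j x)) + c i * g i x)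
      = L_distr \<alpha> \<Phi> (\<lambda>x. f x + (\<Sum>j\<in>J. c j * g j x)) + c i * L_distr \<alpha> \<Phi> (g i)"
    by (rule L_distr_add_cmult[OF assms(1-3) smooth_S4_sum[OF _ assms(5)]]) (use insert.prems in auto)
  then show ?case
    using insert by (simp add: algebra_simps)
qed auto

section \<open>Localisation at p\<close>

lemma radial_ext_cutoff_mult:
  assumes "x \<noteq> 0"
  shows "radial_ext (\<lambda>x. cutoff p \<epsilon> x * \<psi> x) x = cutoff p \<epsilon> x * radial_ext \<psi> x"
proof -
  have "height p (x /\<^sub>R norm x) = height p x"
    using assms by (simp add: height_def)
  then have "cutoff p \<epsilon> (x /\<^sub>R norm x) = cutoff p \<epsilon> x" by (simp only: cutoff_def)
  then show ?thesis by (simp add: radial_ext_def)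
qed

lemma smooth_S4_cutoff_mult:
  assumes "smooth_S4 \<psi>"
  shows "smooth_S4 (\<lambda>x. cutoff p \<epsilon> x * \<psi> x)"
  unfolding smooth_S4_iff
  by (rule smooth_punctured_cong[OF radial_ext_cutoff_mult[symmetric]
        smooth_punctured_mult[OF smooth_punctured_cutoff assms[unfolded smooth_S4_iff]]])

text \<open>The cutoff has order 0 and \<psi> has order 2, so the product has order 2, and the
  fourth-order operator lowers this to -2.\<close>

lemma cutoff_mult_bounds:
  assumes "norm p = 1" "smooth_S4 \<psi>" "\<psi> p = 0"
    and "\<And>v. frechet_derivative (radial_ext \<psi>) (at p) v = 0"
  shows "\<exists>A\<ge>0. \<forall>\<epsilon> \<xi>. 0 < \<epsilon> \<longrightarrow> \<epsilon> \<le> 1 / 4 \<longrightarrow> \<xi> \<in> S4 \<longrightarrow>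
    \<bar>P4_S4 (\<lambda>x. cutoff p \<epsilon> x * \<psi> x) \<xi>\<bar> \<le> A * inverse (\<epsilon>\<^sup>2) * indicator (cap p \<epsilon>) \<xi> \<and>
    \<bar>cutoff p \<epsilon> \<xi> * \<psi> \<xi>\<bar> \<le> A * \<epsilon>\<^sup>2"
proof -
  let ?F = "radial_ext \<psi>" and ?G = "\<lambda>\<epsilon> x. cutoff p \<epsilon> x * radial_ext \<psi> x"
  have F: "smooth_punctured ?F" using assms(2) by (simp add: smooth_S4_iff)
  have G: "smooth_punctured (?G \<epsilon>)" for \<epsilon>
    by (intro smooth_punctured_mult smooth_punctured_cutoff F)
  have "scaled_order p 4 (0 + 2) ?G"
    using assms by (intro scaled_order_mult smooth_punctured_cutoff F scaled_order_cutoff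
        scaled_order_vanishing_2) (simp_all add: radial_ext_sphere)
  then have ord: "scaled_order p 4 2 ?G" by simp
  obtain A where A: "A \<ge> 0" "\<forall>\<epsilon> \<xi>. 0 < \<epsilon> \<longrightarrow> \<epsilon> \<le> 1 / 4 \<longrightarrow> \<xi> \<in> cap p \<epsilon> \<longrightarrow> \<bar>?G \<epsilon> \<xi>\<bar> \<le> A * \<epsilon> powi 2"
    by (rule scaled_boundE[OF scaled_order_bound[OF ord]])
  obtain B where B: "B \<ge> 0"
    "\<forall>\<epsilon> \<xi>. 0 < \<epsilon> \<longrightarrow> \<epsilon> \<le> 1 / 4 \<longrightarrow> \<xi> \<in> cap p \<epsilon> \<longrightarrow> \<bar>sph_paneitz (?G \<epsilon>) \<xi>\<bar> \<le> B * \<epsilon> powi (2 - 4)"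
    by (rule scaled_boundE[OF scaled_bound_sph_paneitz[OF G ord]])
  have P: "P4_S4 (\<lambda>x. cutoff p \<epsilon> x * \<psi> x) \<xi> = sph_paneitz (?G \<epsilon>) \<xi>" if "\<xi> \<in> S4" for \<epsilon> \<xi>
  proof -
    have "P4_S4 (\<lambda>x. cutoff p \<epsilon> x * \<psi> x) \<xi> = sph_paneitz (radial_ext (\<lambda>x. cutoff p \<epsilon> x * \<psi> x)) \<xi>"
      using smooth_S4_cutoff_mult[OF assms(2)] that by (intro P4_S4_eq_sph_paneitz) (simp_all add: smooth_S4_iff)
    also have "\<dots> = sph_paneitz (?G \<epsilon>) \<xi>"
      by (rule sph_paneitz_cong_open[of "- {0}", symmetric])
        (use that G radial_ext_cutoff_mult in auto)
    finally show ?thesis .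
  qed
  have "\<bar>P4_S4 (\<lambda>x. cutoff p \<epsilon> x * \<psi> x) \<xi>\<bar> \<le> (A + B) * inverse (\<epsilon>\<^sup>2) * indicator (cap p \<epsilon>) \<xi> \<and>
    \<bar>cutoff p \<epsilon> \<xi> * \<psi> \<xi>\<bar> \<le> (A + B) * \<epsilon>\<^sup>2"
    if \<epsilon>: "0 < \<epsilon>" "\<epsilon> \<le> 1 / 4" and \<xi>: "\<xi> \<in> S4" for \<epsilon> \<xi>
  proof (cases "\<xi> \<in> cap p \<epsilon>")
    case True
    have "\<bar>sph_paneitz (?G \<epsilon>) \<xi>\<bar> \<le> B * inverse (\<epsilon>\<^sup>2)"
      using B(2)[rule_format, OF \<epsilon> True] by (simp add: power_int_minus)
    also have "\<dots> \<le> (A + B) * inverse (\<epsilon>\<^sup>2)"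
      using A(1) by (intro mult_right_mono) auto
    finally have 1: "\<bar>sph_paneitz (?G \<epsilon>) \<xi>\<bar> \<le> (A + B) * inverse (\<epsilon>\<^sup>2)" .
    have "\<bar>?G \<epsilon> \<xi>\<bar> \<le> A * \<epsilon>\<^sup>2"
      using A(2)[rule_format, OF \<epsilon> True] by simp
    also have "\<dots> \<le> (A + B) * \<epsilon>\<^sup>2"
      using B(1) by (intro mult_right_mono) auto
    finally have "\<bar>?G \<epsilon> \<xi>\<bar> \<le> (A + B) * \<epsilon>\<^sup>2" .
    with 1 show ?thesis
      using True P[OF \<xi>] radial_ext_sphere[OF \<xi>, of \<psi>] by simp
  next
    case False
    \<comment> \<open>The cutoff must vanish on a neighbourhood of \<xi>, not only at \<xi>, for its
      derivatives to disappear. The radius 2 \<epsilon> of the cap leaves room for this: outside it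
      the height is at least 2 \<epsilon>^2, while the cutoff is zero from \<epsilon>^2 on.\<close>
    let ?W = "- {0} \<inter> height p -` {\<epsilon>\<^sup>2<..}"
    have W: "open ?W"
      using continuous_open_preimage[OF smooth_punctured_continuous[OF smooth_punctured_height], of "{\<epsilon>\<^sup>2<..}"]
      by (simp add: open_Compl)
    have zero: "cutoff p \<epsilon> x = 0" if "x \<in> ?W" for x
      using that \<epsilon> by (intro cutoff_eq_0) auto
    have "2 * \<epsilon> \<le> norm (\<xi> - p)" using False \<xi> by (simp add: cap_def)
    then have "(2 * \<epsilon>)\<^sup>2 \<le> (norm (\<xi> - p))\<^sup>2" using \<epsilon> by (intro power_mono) auto
    then have "4 * \<epsilon>\<^sup>2 \<le> (norm (\<xi> - p))\<^sup>2" by (simp add: power_mult_distrib)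
    moreover have "0 < \<epsilon>\<^sup>2" using \<epsilon> by simp
    ultimately have "height p \<xi> > \<epsilon>\<^sup>2"
      unfolding height_sphere[OF assms(1) \<xi>] by linarith
    then have \<xi>W: "\<xi> \<in> ?W" using \<xi> by auto
    have "sph_paneitz (?G \<epsilon>) \<xi> = sph_paneitz (\<lambda>x. 0) \<xi>"
      by (rule sph_paneitz_cong_open[OF W _ \<xi>W G]) (use zero in auto)
    then show ?thesis
      using P[OF \<xi>] zero[OF \<xi>W] A(1) B(1) \<epsilon>(1) by (simp add: sph_paneitz_0)
  qed
  then show ?thesis
    using A(1) B(1) by (intro exI[of _ "A + B"]) auto
qed

lemma L_op_cutoff_mult_bound:
  assumes "0 < \<alpha>" "\<alpha> < 4" "norm p = 1" "smooth_S4 \<psi>" "\<psi> p = 0"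
    and "\<And>v. frechet_derivative (radial_ext \<psi>) (at p) v = 0"
  shows "\<exists>A\<ge>0. \<forall>\<epsilon> \<xi>. 0 < \<epsilon> \<longrightarrow> \<epsilon> \<le> 1 / 4 \<longrightarrow> \<xi> \<in> S4 \<longrightarrow>
    \<bar>L_op \<alpha> (\<lambda>x. cutoff p \<epsilon> x * \<psi> x) \<xi>\<bar> \<le> A * (inverse (\<epsilon>\<^sup>2) * indicator (cap p \<epsilon>) \<xi> + \<epsilon>\<^sup>2)"
proof -
  obtain A where A: "A \<ge> 0" "\<forall>\<epsilon> \<xi>. 0 < \<epsilon> \<longrightarrow> \<epsilon> \<le> 1 / 4 \<longrightarrow> \<xi> \<in> S4 \<longrightarrow>
    \<bar>P4_S4 (\<lambda>x. cutoff p \<epsilon> x * \<psi> x) \<xi>\<bar> \<le> A * inverse (\<epsilon>\<^sup>2) * indicator (cap p \<epsilon>) \<xi> \<and>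
    \<bar>cutoff p \<epsilon> \<xi> * \<psi> \<xi>\<bar> \<le> A * \<epsilon>\<^sup>2"
    using cutoff_mult_bounds[OF assms(3-6)] by blast
  obtain K where K: "K \<ge> 0" "\<forall>\<psi> B. smooth_S4 \<psi> \<longrightarrow> (\<forall>\<xi>\<in>S4. \<bar>\<psi> \<xi>\<bar> \<le> B) \<longrightarrow>
    (\<forall>\<xi>\<in>S4. \<bar>kappa \<alpha> * (R_op \<alpha> \<psi> \<xi> + mu0 \<alpha> \<xi> * \<psi> \<xi>)\<bar> \<le> K * B)"
    using nonlocal_part_bound[OF assms(1,2)] by blast
  have "\<bar>L_op \<alpha> (\<lambda>x. cutoff p \<epsilon> x * \<psi> x) \<xi>\<bar>
      \<le> (A + K * A) * (inverse (\<epsilon>\<^sup>2) * indicator (cap p \<epsilon>) \<xi> + \<epsilon>\<^sup>2)"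
    if \<epsilon>: "0 < \<epsilon>" "\<epsilon> \<le> 1 / 4" and \<xi>: "\<xi> \<in> S4" for \<epsilon> \<xi>
  proof -
    let ?\<chi> = "\<lambda>x. cutoff p \<epsilon> x * \<psi> x" and ?i = "inverse (\<epsilon>\<^sup>2) * indicator (cap p \<epsilon>) \<xi> :: real"
    have "\<forall>\<xi>\<in>S4. \<bar>?\<chi> \<xi>\<bar> \<le> A * \<epsilon>\<^sup>2"
      using A(2)[rule_format, OF \<epsilon>] by blast
    then have "\<bar>kappa \<alpha> * (R_op \<alpha> ?\<chi> \<xi> + mu0 \<alpha> \<xi> * ?\<chi> \<xi>)\<bar> \<le> K * (A * \<epsilon>\<^sup>2)"
      using K(2)[rule_format, OF smooth_S4_cutoff_mult[OF assms(4)] _ \<xi>] by blast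
    moreover have "\<bar>P4_S4 ?\<chi> \<xi>\<bar> \<le> A * ?i"
      using A(2)[rule_format, OF \<epsilon> \<xi>] by (simp add: mult.assoc)
    ultimately have "\<bar>L_op \<alpha> ?\<chi> \<xi>\<bar> \<le> A * ?i + K * (A * \<epsilon>\<^sup>2)"
      unfolding L_op_def by linarith
    moreover have "0 \<le> K * A * ?i" "0 \<le> A * \<epsilon>\<^sup>2"
      using A(1) K(1) by simp_all
    ultimately show ?thesis by (simp add: algebra_simps)
  qed
  then show ?thesis
    using A(1) K(1) by (intro exI[of _ "A + K * A"]) simp
qed

lemma cap_in_sets [measurable]: "cap p \<epsilon> \<in> sets surface_measure"
proof -
  have "cap p \<epsilon> = ball p (2 * \<epsilon>) \<inter> S4"
    by (auto simp: cap_def dist_norm norm_minus_commute)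
  then show ?thesis by (simp add: sets_surface_measureI)
qed

lemma measure_cap:
  assumes "norm p = 1" "0 < \<epsilon>" "\<epsilon> \<le> 1 / 4"
  shows "measure surface_measure (cap p \<epsilon>) \<le> 16 * cap_const * \<epsilon> ^ 4"
proof -
  have "emeasure surface_measure (cap p \<epsilon>) \<le> emeasure surface_measure {\<eta> \<in> S4. norm (\<eta> - p) \<le> 2 * \<epsilon>}"
    by (rule emeasure_mono[OF _ closed_cap_in_sets]) (auto simp: cap_def)
  also have "\<dots> \<le> ennreal (cap_const * (2 * \<epsilon>) ^ 4)"
    using assms by (intro emeasure_closed_cap) auto
  finally show ?thesis
    using cap_const_pos assms(2) by (simp add: surface.emeasure_eq_measure power_mult_distrib mult_ac)
qed

text \<open>The caps shrink to the point p, which lies in all of them, so dominated convergence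
  gives the limit 0 once that point is known to be a null set; the \<epsilon>^4 bound on the caps
  shows this. The radii start at 1 / 4, the largest value that \<open>measure_cap\<close>
  admits.\<close>

lemma square_mass_cap_tendsto_0:
  assumes "norm p = 1" "square_integrable_S4 \<Phi>"
  shows "(\<lambda>n. LINT \<xi>|surface_measure. (\<Phi> \<xi>)\<^sup>2 * indicator (cap p (1 / real (n + 4))) \<xi>) \<longlonglongrightarrow> 0"
proof -
  have [measurable]: "\<Phi> \<in> borel_measurable surface_measure"
    using assms(2) by (simp add: square_integrable_S4_def)
  have p: "{p} \<in> sets surface_measure"
    using sets_surface_measureI[of "{p}"] assms(1) by simp
  have lim: "(\<lambda>n. 1 / real (n + 4)) \<longlonglongrightarrow> 0"
    using LIMSEQ_ignore_initial_segment[OF lim_1_over_n, of 4] by simp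
  have "measure surface_measure {p} \<le> 16 * cap_const * (1 / real (n + 4)) ^ 4" for n
  proof -
    have "measure surface_measure {p} \<le> measure surface_measure (cap p (1 / real (n + 4)))"
      by (rule surface.finite_measure_mono[OF _ cap_in_sets]) (use assms(1) in \<open>auto simp: cap_def\<close>)
    also have "\<dots> \<le> 16 * cap_const * (1 / real (n + 4)) ^ 4"
      by (rule measure_cap[OF assms(1)]) auto
    finally show ?thesis .
  qed
  moreover have "(\<lambda>n. 16 * cap_const * (1 / real (n + 4)) ^ 4) \<longlonglongrightarrow> 16 * cap_const * 0 ^ 4"
    by (intro tendsto_intros lim)
  ultimately have "measure surface_measure {p} \<le> 0"
    by (intro LIMSEQ_le_const[where X = "\<lambda>n. 16 * cap_const * (1 / real (n + 4)) ^ 4"]) auto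
  then have "measure surface_measure {p} = 0"
    using measure_nonneg[of surface_measure "{p}"] by linarith
  then have null: "AE \<xi> in surface_measure. \<xi> \<noteq> p"
    using p by (intro AE_I[of _ _ "{p}"]) (auto simp: surface.emeasure_eq_measure)
  have "(\<lambda>n. LINT \<xi>|surface_measure. (\<Phi> \<xi>)\<^sup>2 * indicator (cap p (1 / real (n + 4))) \<xi>)
      \<longlonglongrightarrow> (LINT \<xi>|surface_measure. 0)"
  proof (rule integral_dominated_convergence[where w = "\<lambda>\<xi>. (\<Phi> \<xi>)\<^sup>2"])
    show "integrable surface_measure (\<lambda>\<xi>. (\<Phi> \<xi>)\<^sup>2)"
      using assms(2) by (simp add: square_integrable_S4_def)
    show "AE \<xi> in surface_measure. (\<lambda>n. (\<Phi> \<xi>)\<^sup>2 * indicator (cap p (1 / real (n + 4))) \<xi>) \<longlonglongrightarrow> 0"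
    proof (rule AE_mp[OF null], intro AE_I2 impI)
      fix \<xi> assume "\<xi> \<noteq> p"
      then have "\<forall>\<^sub>F n in sequentially. 1 / real (n + 4) < norm (\<xi> - p) / 2"
        by (intro order_tendstoD(2)[OF lim]) simp
      then have "\<forall>\<^sub>F n in sequentially. (\<Phi> \<xi>)\<^sup>2 * indicator (cap p (1 / real (n + 4))) \<xi> = 0"
        by eventually_elim (auto simp: cap_def indicator_def)
      then show "(\<lambda>n. (\<Phi> \<xi>)\<^sup>2 * indicator (cap p (1 / real (n + 4))) \<xi>) \<longlonglongrightarrow> 0"
        by (rule tendsto_eventually)
    qed
    show "AE \<xi> in surface_measure. norm ((\<Phi> \<xi>)\<^sup>2 * indicator (cap p (1 / real (n + 4))) \<xi>) \<le> (\<Phi> \<xi>)\<^sup>2" for n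
      by (intro AE_I2) (simp add: indicator_def)
  qed simp_all
  then show ?thesis by simp
qed

text \<open>Within chordal distance \<epsilon> of p the height is at most \<epsilon>^2 / 2, so the
  cutoff is 1 there and the difference is supported in a closed set that misses p. The difference is
  written with the factor -1 to fit \<open>L_distr_add_cmult\<close>.\<close>

lemma subtract_cutoff_mult_test_function:
  assumes "norm p = 1" "smooth_S4 \<psi>" "0 < \<epsilon>"
  shows "(\<lambda>x. \<psi> x + (- 1) * (cutoff p \<epsilon> x * \<psi> x)) \<in> test_functions (S4 - {p})"
proof -
  have "closure {\<xi> \<in> S4. \<psi> \<xi> + (- 1) * (cutoff p \<epsilon> \<xi> * \<psi> \<xi>) \<noteq> 0} \<subseteq> S4 - ball p \<epsilon>"
  proof (rule closure_minimal)
    show "{\<xi> \<in> S4. \<psi> \<xi> + (- 1) * (cutoff p \<epsilon> \<xi> * \<psi> \<xi>) \<noteq> 0} \<subseteq> S4 - ball p \<epsilon>"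
    proof safe
      fix \<xi> assume \<xi>: "\<xi> \<in> S4" "\<psi> \<xi> + (- 1) * (cutoff p \<epsilon> \<xi> * \<psi> \<xi>) \<noteq> 0" "\<xi> \<in> ball p \<epsilon>"
      then have "(norm (\<xi> - p))\<^sup>2 \<le> \<epsilon>\<^sup>2"
        by (intro power_mono) (auto simp: dist_norm norm_minus_commute)
      then have "cutoff p \<epsilon> \<xi> = 1"
        by (intro cutoff_eq_1) (use assms(3) height_sphere[OF assms(1) \<xi>(1)] in auto)
      with \<xi>(2) show False by simp
    qed
    show "closed (S4 - ball p \<epsilon>)" by (intro closed_Diff closed_sphere open_ball)
  qed
  moreover have "p \<in> ball p \<epsilon>" using assms(3) by simp
  ultimately show ?thesis
    unfolding test_functions_def
    using smooth_S4_add_cmult[OF assms(2) smooth_S4_cutoff_mult[OF assms(2)]] by blast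
qed

text \<open>A weighted arithmetic-geometric inequality takes the place of Cauchy-Schwarz. The term
  \<epsilon>^(-4) times the measure of the cap is bounded but does not tend to zero, and the weight
  1 / s is there to make it small afterwards.\<close>

lemma L_distr_cutoff_mult_bound:
  assumes "0 < \<alpha>" "\<alpha> < 4" "norm p = 1" "square_integrable_S4 \<Phi>" "smooth_S4 \<psi>" "0 < \<epsilon>" "\<epsilon> \<le> 1 / 4"
    and "A \<ge> 0" "\<And>\<xi>. \<xi> \<in> S4 \<Longrightarrow>
      \<bar>L_op \<alpha> (\<lambda>x. cutoff p \<epsilon> x * \<psi> x) \<xi>\<bar> \<le> A * (inverse (\<epsilon>\<^sup>2) * indicator (cap p \<epsilon>) \<xi> + \<epsilon>\<^sup>2)"
    and "s > 0"
  shows "\<bar>L_distr \<alpha> \<Phi> (\<lambda>x. cutoff p \<epsilon> x * \<psi> x)\<bar> \<le> A * (s * (LINT \<xi>|surface_measure. (\<Phi> \<xi>)\<^sup>2 * indicator (cap p \<epsilon>) \<xi>)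
    + inverse s * (16 * cap_const) + \<epsilon>\<^sup>2 * (LINT \<xi>|surface_measure. \<bar>\<Phi> \<xi>\<bar>))"
proof -
  let ?\<chi> = "\<lambda>x. cutoff p \<epsilon> x * \<psi> x" and ?c = "\<lambda>\<xi>. indicator (cap p \<epsilon>) \<xi> :: real"
  let ?w = "\<lambda>\<xi>. s * ((\<Phi> \<xi>)\<^sup>2 * ?c \<xi>) + inverse s * (inverse (\<epsilon> ^ 4) * ?c \<xi>) + \<epsilon>\<^sup>2 * \<bar>\<Phi> \<xi>\<bar>"
  have [measurable]: "\<Phi> \<in> borel_measurable surface_measure"
    using assms(4) by (simp add: square_integrable_S4_def)
  have I1: "integrable surface_measure (\<lambda>\<xi>. (\<Phi> \<xi>)\<^sup>2 * ?c \<xi>)"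
    using assms(4) cap_in_sets by (intro integrable_real_mult_indicator) (auto simp: square_integrable_S4_def)
  have I2: "integrable surface_measure ?c"
    by (simp add: cap_in_sets surface.emeasure_eq_measure)
  have I3: "integrable surface_measure (\<lambda>\<xi>. \<bar>\<Phi> \<xi>\<bar>)"
    using square_integrable_imp_integrable[OF assms(4)] by simp
  have Iw: "integrable surface_measure (\<lambda>\<xi>. A * ?w \<xi>)"
    using I1 I2 I3 by simp
  have amgm: "a * b \<le> s * a\<^sup>2 + inverse s * b\<^sup>2" if "a \<ge> 0" "b \<ge> 0" for a b :: real
  proof -
    \<comment> \<open>Multiplied by s, the claim says that s^2 a^2 - s a b + b^2 is nonnegative, and
      this completes the square.\<close>
    have "0 \<le> (s * a - b / 2)\<^sup>2 + 3 / 4 * b\<^sup>2" by simp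
    also have "\<dots> = s * (s * a\<^sup>2 + inverse s * b\<^sup>2 - a * b)"
      using assms(10) by (simp add: power2_eq_square field_simps)
    finally show ?thesis
      using assms(10) by (simp add: zero_le_mult_iff)
  qed
  have le: "norm (\<Phi> \<xi> * L_op \<alpha> ?\<chi> \<xi>) \<le> A * ?w \<xi>" if \<xi>: "\<xi> \<in> S4" for \<xi>
  proof -
    have "norm (\<Phi> \<xi> * L_op \<alpha> ?\<chi> \<xi>) \<le> \<bar>\<Phi> \<xi>\<bar> * (A * (inverse (\<epsilon>\<^sup>2) * ?c \<xi> + \<epsilon>\<^sup>2))"
      using assms(9)[OF \<xi>] by (simp add: abs_mult mult_left_mono)
    also have "\<dots> = A * (\<bar>\<Phi> \<xi>\<bar> * inverse (\<epsilon>\<^sup>2) * ?c \<xi> + \<epsilon>\<^sup>2 * \<bar>\<Phi> \<xi>\<bar>)"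
      by (simp add: algebra_simps)
    also have "\<dots> \<le> A * ?w \<xi>"
      using amgm[of "\<bar>\<Phi> \<xi>\<bar>" "inverse (\<epsilon>\<^sup>2)"] assms(8)
      by (intro mult_left_mono) (auto simp: indicator_def power_inverse[symmetric] simp flip: power_mult)
    finally show ?thesis .
  qed
  have "norm (L_distr \<alpha> \<Phi> ?\<chi>) \<le> (LINT \<xi>|surface_measure. A * ?w \<xi>)"
    unfolding L_distr_def
    by (rule Bochner_Integration.integral_norm_bound_integral[OF
          L_distr_integrable[OF assms(1,2,4) smooth_S4_cutoff_mult[OF assms(5)]] Iw]) (use le in simp)
  also have "\<dots> = A * (s * (LINT \<xi>|surface_measure. (\<Phi> \<xi>)\<^sup>2 * ?c \<xi>)
      + inverse s * (inverse (\<epsilon> ^ 4) * measure surface_measure (cap p \<epsilon>))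
      + \<epsilon>\<^sup>2 * (LINT \<xi>|surface_measure. \<bar>\<Phi> \<xi>\<bar>))"
  proof -
    have "cap p \<epsilon> \<inter> S4 = cap p \<epsilon>" by (auto simp: cap_def)
    then show ?thesis using I1 I2 I3 by simp
  qed
  also have "\<dots> \<le> A * (s * (LINT \<xi>|surface_measure. (\<Phi> \<xi>)\<^sup>2 * ?c \<xi>)
      + inverse s * (16 * cap_const) + \<epsilon>\<^sup>2 * (LINT \<xi>|surface_measure. \<bar>\<Phi> \<xi>\<bar>))"
  proof -
    have "inverse (\<epsilon> ^ 4) * measure surface_measure (cap p \<epsilon>) \<le> inverse (\<epsilon> ^ 4) * (16 * cap_const * \<epsilon> ^ 4)"
      using measure_cap[OF assms(3,6,7)] assms(6) by (intro mult_left_mono) auto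
    also have "\<dots> = 16 * cap_const" using assms(6) by simp
    finally show ?thesis
      using assms(8,10) by (intro mult_left_mono add_mono order_refl) auto
  qed
  finally show ?thesis by simp
qed

lemma L_distr_vanishing_2:
  assumes "0 < \<alpha>" "\<alpha> < 4" "norm p = 1" "square_integrable_S4 \<Phi>"
    and "distr_eq_on (S4 - {p}) (L_distr \<alpha> \<Phi>) (\<lambda>\<psi>. 0)"
    and "smooth_S4 \<psi>" "\<psi> p = 0" "\<And>v. frechet_derivative (radial_ext \<psi>) (at p) v = 0"
  shows "L_distr \<alpha> \<Phi> \<psi> = 0"
proof -
  let ?T = "L_distr \<alpha> \<Phi>" and ?\<chi> = "\<lambda>\<epsilon> x. cutoff p \<epsilon> x * \<psi> x"
  let ?I = "\<lambda>\<epsilon>. LINT \<xi>|surface_measure. (\<Phi> \<xi>)\<^sup>2 * indicator (cap p \<epsilon>) \<xi>"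
  let ?N = "LINT \<xi>|surface_measure. \<bar>\<Phi> \<xi>\<bar>"
  obtain A where A: "A \<ge> 0" "\<forall>\<epsilon> \<xi>. 0 < \<epsilon> \<longrightarrow> \<epsilon> \<le> 1 / 4 \<longrightarrow> \<xi> \<in> S4 \<longrightarrow>
    \<bar>L_op \<alpha> (?\<chi> \<epsilon>) \<xi>\<bar> \<le> A * (inverse (\<epsilon>\<^sup>2) * indicator (cap p \<epsilon>) \<xi> + \<epsilon>\<^sup>2)"
    using L_op_cutoff_mult_bound[OF assms(1-3,6-8)] by blast
  have eq: "?T \<psi> = ?T (?\<chi> \<epsilon>)" if "\<epsilon> > 0" for \<epsilon>
  proof -
    have "?T (\<lambda>x. \<psi> x + (- 1) * ?\<chi> \<epsilon> x) = 0"
      using assms(5) subtract_cutoff_mult_test_function[OF assms(3,6) that]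
      unfolding distr_eq_on_def by blast
    then show ?thesis
      using L_distr_add_cmult[OF assms(1,2,4,6) smooth_S4_cutoff_mult[OF assms(6)], of "- 1" p \<epsilon>] by simp
  qed
  \<comment> \<open>The order of limits matters: \<epsilon> tends to 0 at fixed s, which removes the
    mass of \<Phi>^2 on the cap and the nonlocal term. Only afterwards does s tend to
    infinity.\<close>
  have le: "\<bar>?T \<psi>\<bar> \<le> A * (inverse s * (16 * cap_const))" if s: "s > 0" for s
  proof (rule LIMSEQ_le_const)
    have lim: "(\<lambda>n. 1 / real (n + 4)) \<longlonglongrightarrow> 0"
      using LIMSEQ_ignore_initial_segment[OF lim_1_over_n, of 4] by simp
    have "(\<lambda>n. A * (s * ?I (1 / real (n + 4)) + inverse s * (16 * cap_const) + (1 / real (n + 4))\<^sup>2 * ?N))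
        \<longlonglongrightarrow> A * (s * 0 + inverse s * (16 * cap_const) + 0\<^sup>2 * ?N)"
      by (intro tendsto_intros lim square_mass_cap_tendsto_0[OF assms(3,4)])
    then show "(\<lambda>n. A * (s * ?I (1 / real (n + 4)) + inverse s * (16 * cap_const) + (1 / real (n + 4))\<^sup>2 * ?N))
        \<longlonglongrightarrow> A * (inverse s * (16 * cap_const))"
      by simp
    have "\<bar>?T \<psi>\<bar> \<le> A * (s * ?I (1 / real (n + 4)) + inverse s * (16 * cap_const) + (1 / real (n + 4))\<^sup>2 * ?N)" for n
    proof -
      have \<epsilon>: "0 < 1 / real (n + 4)" "1 / real (n + 4) \<le> 1 / 4" by (simp_all add: field_simps)
      show ?thesis
        unfolding eq[OF \<epsilon>(1)]
        by (rule L_distr_cutoff_mult_bound[OF assms(1-4,6) \<epsilon> A(1) A(2)[rule_format, OF \<epsilon>] s])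
    qed
    then show "\<exists>n0. \<forall>n\<ge>n0. \<bar>?T \<psi>\<bar> \<le> A * (s * ?I (1 / real (n + 4)) + inverse s * (16 * cap_const) + (1 / real (n + 4))\<^sup>2 * ?N)"
      by blast
  qed
  have "\<bar>?T \<psi>\<bar> \<le> 0"
  proof (rule LIMSEQ_le_const)
    have "(\<lambda>n. A * (inverse (real (Suc n)) * (16 * cap_const))) \<longlonglongrightarrow> A * (0 * (16 * cap_const))"
      by (intro tendsto_intros LIMSEQ_inverse_real_of_nat)
    then show "(\<lambda>n. A * (inverse (real (Suc n)) * (16 * cap_const))) \<longlonglongrightarrow> 0" by simp
    show "\<exists>n0. \<forall>n\<ge>n0. \<bar>?T \<psi>\<bar> \<le> A * (inverse (real (Suc n)) * (16 * cap_const))"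
      using le[OF of_nat_0_less_iff[THEN iffD2, OF zero_less_Suc]] by blast
  qed
  then show ?thesis by simp
qed

section \<open>Geodesic coordinates and the differential at p\<close>

lemma partial_z_eq_frechet_derivative:
  assumes "p \<in> S4" "orthonormal_tangent_frame p e" "smooth_S4 \<psi>"
  shows "partial_z p e j \<psi> = frechet_derivative (radial_ext \<psi>) (at p) (e j)"
proof -
  let ?\<gamma> = "\<lambda>t. geodesic_param p e (t *\<^sub>R axis j 1)"
  have p: "p \<bullet> p = 1" "p \<noteq> 0" using assms(1) by (auto simp: norm_eq_1)
  have e: "e j \<bullet> p = 0" "e j \<bullet> e j = 1"
    using assms(2) by (auto simp: orthonormal_tangent_frame_def)
  have \<gamma>: "?\<gamma> t = cos t *\<^sub>R p + sin t *\<^sub>R e j" for t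
  proof -
    have "(\<Sum>k\<in>UNIV. (t *\<^sub>R axis j 1 :: real ^ 4) $ k *\<^sub>R e k) = (\<Sum>k\<in>UNIV. if k = j then t *\<^sub>R e k else 0)"
      by (rule sum.cong) (auto simp: axis_def)
    then have "(\<Sum>k\<in>UNIV. (t *\<^sub>R axis j 1 :: real ^ 4) $ k *\<^sub>R e k) = t *\<^sub>R e j" by simp
    then show ?thesis
      \<comment> \<open>The norm of the argument is |t|, but cos |t| and sin |t| / |t| are even, so
        the sign drops out. At t = 0 the quotient is 0 by convention and the tangential term
        vanishes anyway.\<close>
      by (cases "t = 0") (auto simp: geodesic_param_def abs_if)
  qed
  have "norm (?\<gamma> t) = 1" for t
    unfolding \<gamma> norm_eq_1
    by (simp add: inner_add_left inner_add_right p e inner_commute[of p "e j"] sin_cos_squared_add3)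
  then have \<psi>: "\<psi> (?\<gamma> t) = radial_ext \<psi> (cos t *\<^sub>R p + sin t *\<^sub>R e j)" for t
    by (simp add: radial_ext_def flip: \<gamma>)
  have D: "(radial_ext \<psi> has_derivative frechet_derivative (radial_ext \<psi>) (at p)) (at p)"
    using assms(3) p by (intro smooth_punctured_has_derivative) (simp_all add: smooth_S4_iff)
  have "((\<lambda>t. cos t *\<^sub>R p + sin t *\<^sub>R e j) has_derivative (\<lambda>t. t *\<^sub>R e j)) (at 0)"
    by (auto intro!: derivative_eq_intros)
  then have "((\<lambda>t. radial_ext \<psi> (cos t *\<^sub>R p + sin t *\<^sub>R e j)) has_derivative
      (\<lambda>t. frechet_derivative (radial_ext \<psi>) (at p) (t *\<^sub>R e j))) (at 0)"
    by (rule has_derivative_compose) (simp add: D)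
  then have "((\<lambda>t. \<psi> (?\<gamma> t)) has_derivative (\<lambda>t. frechet_derivative (radial_ext \<psi>) (at p) (e j) * t)) (at 0)"
    by (simp add: \<psi> linear_cmul[OF has_derivative_linear[OF D]] mult.commute)
  then have "((\<lambda>t. \<psi> (?\<gamma> t)) has_field_derivative frechet_derivative (radial_ext \<psi>) (at p) (e j)) (at 0)"
    by (simp add: has_field_derivative_def)
  then show ?thesis by (simp add: partial_z_def DERIV_imp_deriv)
qed

lemma frechet_derivative_radial_ext_normal:
  assumes "p \<in> S4" "smooth_S4 \<psi>"
  shows "frechet_derivative (radial_ext \<psi>) (at p) p = 0"
proof -
  have p: "p \<noteq> 0" using assms(1) by auto
  have D: "(radial_ext \<psi> has_derivative frechet_derivative (radial_ext \<psi>) (at p)) (at p)"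
    using assms(2) p by (intro smooth_punctured_has_derivative) (simp_all add: smooth_S4_iff)
  have "((\<lambda>t. radial_ext \<psi> (t *\<^sub>R p)) has_derivative
      (\<lambda>t. frechet_derivative (radial_ext \<psi>) (at p) (t *\<^sub>R p))) (at 1)"
    by (rule has_derivative_compose[where f = "\<lambda>t. t *\<^sub>R p" and g = "radial_ext \<psi>"])
      (auto intro!: derivative_eq_intros simp: D)
  moreover have "((\<lambda>t. radial_ext \<psi> (t *\<^sub>R p)) has_derivative (\<lambda>t. 0)) (at 1)"
  proof (rule has_derivative_transform_within_open)
    show "((\<lambda>t. radial_ext \<psi> p) has_derivative (\<lambda>t. 0)) (at (1 :: real))" by simp
    show "radial_ext \<psi> p = radial_ext \<psi> (t *\<^sub>R p)" if "t \<in> {0<..}" for t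
      using degree_0_radial_ext[of \<psi>] p that by (simp add: degree_0_def)
  qed auto
  ultimately have "(\<lambda>t. frechet_derivative (radial_ext \<psi>) (at p) (t *\<^sub>R p)) = (\<lambda>t. 0)"
    by (rule has_derivative_unique)
  from fun_cong[OF this, of 1] show ?thesis by simp
qed

text \<open>Four tangent vectors and the normal p form five orthogonal nonzero vectors in dimension
  five. Hence a linear differential that is zero on each of them is zero.\<close>

lemma span_orthonormal_tangent_frame:
  assumes "p \<in> S4" "orthonormal_tangent_frame p e"
  shows "span (insert p (range e)) = UNIV"
proof -
  have orth: "e i \<bullet> e j = (if i = j then 1 else 0)" "e j \<bullet> p = 0" "p \<bullet> e j = 0" for i j
    using assms(2) by (simp_all add: orthonormal_tangent_frame_def inner_commute[of p "e j"])
  have inj: "inj e"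
  proof (rule injI)
    fix i j assume "e i = e j"
    then show "i = j" using orth(1)[of i j] orth(1)[of j j] by (auto split: if_splits)
  qed
  have p: "p \<noteq> 0" using assms(1) by auto
  have p': "p \<notin> range e" using orth(2) p by (metis imageE inner_eq_zero_iff)
  have e0: "e j \<noteq> 0" for j using orth(1)[of j j] by auto
  have "pairwise orthogonal (insert p (range e))"
    by (auto simp: pairwise_def orthogonal_def orth)
  moreover have "0 \<notin> insert p (range e)"
    using p e0 by (auto simp: image_iff)
  ultimately have ind: "independent (insert p (range e))"
    by (rule pairwise_orthogonal_independent)
  have "card (insert p (range e)) = 5"
    using p' inj by (simp add: card_image)
  then have "UNIV \<subseteq> span (insert p (range e))"
    using ind by (intro card_ge_dim_independent) auto
  then show ?thesis by auto
qed

theorem lemma4p4: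
  fixes \<alpha> :: real and p :: "real ^ 5" and \<Phi> :: "real ^ 5 \<Rightarrow> real"
    and e :: "4 \<Rightarrow> real ^ 5"
  assumes "0 < \<alpha>" and "\<alpha> < 4"
    and "p \<in> S4"
    and "square_integrable_S4 \<Phi>"
    and "distr_eq_on (S4 - {p}) (L_distr \<alpha> \<Phi>) (\<lambda>\<psi>. 0)"
    and "orthonormal_tangent_frame p e"
  shows "\<exists>(c0 :: real) (c :: 4 \<Rightarrow> real).
           distr_eq_on S4 (L_distr \<alpha> \<Phi>)
             (\<lambda>\<psi>. c0 * delta p \<psi> + (\<Sum>j\<in>UNIV. c j * partial_delta p e j \<psi>))"
proof -
  let ?T = "L_distr \<alpha> \<Phi>" and ?D = "\<lambda>f. frechet_derivative (radial_ext f) (at p)"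
  let ?l = "\<lambda>j x. x \<bullet> e j"
  have p: "norm p = 1" "p \<noteq> 0" using assms(3) by auto
  have orth: "e i \<bullet> e j = (if i = j then 1 else 0)" "p \<bullet> e j = 0" for i j
    using assms(6) by (simp_all add: orthonormal_tangent_frame_def inner_commute[of p "e j"])
  have Dl: "?D (?l j) (e i) = (if i = j then 1 else 0)" for i j
  proof -
    have "radial_ext (?l j) = (\<lambda>x. (x \<bullet> e j) * inverse (norm x))"
      by (simp add: radial_ext_def fun_eq_iff)
    \<comment> \<open>Differentiating the normalisation contributes a multiple of
      \<open>p \<bullet> e j\<close>, which is zero; the radial extension therefore has the
      differential of the linear function itself.\<close>
    moreover have "((\<lambda>x. (x \<bullet> e j) * inverse (norm x)) has_derivative (\<lambda>v. v \<bullet> e j)) (at p)"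
      using p by (auto intro!: derivative_eq_intros has_derivative_norm simp: orth)
    ultimately have "?D (?l j) = (\<lambda>v. v \<bullet> e j)"
      using frechet_derivative_at by metis
    then show ?thesis by (simp add: orth)
  qed
  \<comment> \<open>The minus sign in the coefficients cancels the one in
    \<open>partial_delta\<close>, so that \<psi> is effectively expanded as its value plus its
    tangential derivatives times the linear functions.\<close>
  have "?T \<psi> = ?T (\<lambda>_. 1) * delta p \<psi> + (\<Sum>j\<in>UNIV. - ?T (?l j) * partial_delta p e j \<psi>)"
    if "\<psi> \<in> test_functions S4" for \<psi>
  proof -
    have \<psi>: "smooth_S4 \<psi>" using that by (simp add: test_functions_def)
    define a where "a j = ?D \<psi> (e j)" for j
    define \<psi>1 where "\<psi>1 = (\<lambda>x. \<psi> x + (- \<psi> p) * 1)"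
    \<comment> \<open>Removes the first-order Taylor part of \<psi> at p: the linear functions
      vanish at p, so the value stays zero, and their differentials are dual to the frame.\<close>
    define \<psi>2 where "\<psi>2 = (\<lambda>x. \<psi>1 x + (\<Sum>j\<in>UNIV. - a j * ?l j x))"
    have s1: "smooth_S4 \<psi>1"
      unfolding \<psi>1_def by (rule smooth_S4_add_cmult[OF \<psi> smooth_S4_const])
    have s2: "smooth_S4 \<psi>2"
      unfolding \<psi>2_def by (rule smooth_S4_sum[OF smooth_S4_inner s1])
    have "?T \<psi>2 = 0"
    proof (rule L_distr_vanishing_2[OF assms(1,2) p(1) assms(4,5) s2])
      show "\<psi>2 p = 0" by (simp add: \<psi>2_def \<psi>1_def orth)
      have der: "(radial_ext f has_derivative ?D f) (at p)" if "smooth_S4 f" for f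
        using that p(2) by (intro smooth_punctured_has_derivative) (simp_all add: smooth_S4_iff)
      have ext: "radial_ext \<psi>2 = (\<lambda>x. radial_ext \<psi> x + (- \<psi> p) + (\<Sum>j\<in>UNIV. - a j * radial_ext (?l j) x))"
        by (simp add: \<psi>2_def \<psi>1_def radial_ext_def fun_eq_iff)
      have "(radial_ext \<psi>2 has_derivative (\<lambda>v. ?D \<psi> v + 0 + (\<Sum>j\<in>UNIV. - a j * ?D (?l j) v))) (at p)"
        unfolding ext
        by (intro has_derivative_add has_derivative_sum has_derivative_mult_right has_derivative_const
            der \<psi> smooth_S4_inner)
      then have D2: "?D \<psi>2 v = ?D \<psi> v + (\<Sum>j\<in>UNIV. - a j * ?D (?l j) v)" for v
        using fun_cong[OF frechet_derivative_at, of "radial_ext \<psi>2" _ p v] by simp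
      have e0: "?D \<psi>2 (e i) = 0" for i
      proof -
        have "(\<Sum>j\<in>UNIV. - a j * ?D (?l j) (e i)) = (\<Sum>j\<in>UNIV. if j = i then - a j else 0)"
          by (rule sum.cong) (auto simp: Dl)
        then show ?thesis by (simp add: D2 a_def)
      qed
      show "?D \<psi>2 v = 0" for v
      proof (rule linear_eq_0_on_span[OF has_derivative_linear[OF der[OF s2]]])
        show "v \<in> span (insert p (range e))"
          using span_orthonormal_tangent_frame[OF assms(3,6)] by simp
      qed (use e0 frechet_derivative_radial_ext_normal[OF assms(3) s2] in auto)
    qed
    moreover have "?T \<psi>2 = ?T \<psi>1 + (\<Sum>j\<in>UNIV. - a j * ?T (?l j))"
      unfolding \<psi>2_def by (rule L_distr_sum[OF assms(1,2,4) smooth_S4_inner s1])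
    moreover have "?T \<psi>1 = ?T \<psi> + (- \<psi> p) * ?T (\<lambda>_. 1)"
      unfolding \<psi>1_def by (rule L_distr_add_cmult[OF assms(1,2,4) \<psi> smooth_S4_const])
    ultimately have "?T \<psi> = ?T (\<lambda>_. 1) * \<psi> p + (\<Sum>j\<in>UNIV. a j * ?T (?l j))"
      by (simp add: sum_negf algebra_simps)
    then show ?thesis
      by (simp add: delta_def partial_delta_def a_def mult.commute
          partial_z_eq_frechet_derivative[OF assms(3,6) \<psi>])
  qed
  then show ?thesis
    unfolding distr_eq_on_def by (intro exI[of _ "?T (\<lambda>_. 1)"] exI[of _ "\<lambda>j. - ?T (?l j)"]) blast
qed

end
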